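(* (i) There exists a positive integer $s$ such that for all graphs $G,H$ having the $s$-extension property, if each of the sentences $\varphi^1_C,\varphi^2_C,\varphi^3_C,\varphi^1_I,\varphi^2_I,\varphi^3_I$ does not differ between $G$ and $H$ (that is, it is true on both or false on both), then no sentence $\varphi\in\mathcal{E}_1^2$ differs between $G$ and $H$. (ii) For every positive integer $s$ and every $$\varphi\in\{\varphi^1_C,\ \neg\varphi^1_C\wedge\neg\varphi^2_C\wedge\varphi^3_C,\ \neg\varphi^1_C\wedge\neg\varphi^2_C\wedge\neg\varphi^3_C,\ \varphi^2_C\wedge\varphi^3_C,\ \varphi^2_C\wedge\neg\varphi^3_C\},$$ there exists a graph $G$ with the $s$-extension property such that $G\models\varphi$; and the same holds with $\varphi^1_C,\varphi^2_C,\varphi^3_C$ replaced by $\varphi^1_I,\varphi^2_I,\varphi^3_I$ respectively.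
   Context: Graphs are finite undirected simple graphs; sentences use relations $\sim$ (adjacency) and $=$. A graph has the $s$-extension property if for every set $S$ of $s$ distinct vertices and every subset $T\subseteq S$ (possibly empty) there is a vertex $z\notin S$ adjacent to every vertex of $T$ and non-adjacent to every vertex of $S\setminus T$. $\mathcal{E}_1^2$ is the class of sentences $\exists X\,\phi(X)$ with a single monadic variable $X$ (ranging over vertex subsets) and $\phi(X)$ a first order sentence in $\sim,=,X$ of quantifier depth 2. Define formulas of a set variable $X$: $\mathrm{cl}(X)$: any two distinct vertices of $X$ are adjacent; $\max\mathrm{cl}(X)$: $\mathrm{cl}(X)$ holds and there is no vertex outside $X$ adjacent to all vertices of $X$; $\varphi_C(X)$: there is a vertex outside $X$ adjacent to no vertex of $X$; $\mathrm{ind}(X)$: no two vertices of $X$ are adjacent; $\max\mathrm{ind}(X)$: $\mathrm{ind}(X)$ holds and there is no vertex outside $X$ adjacent to no vertex of $X$; $\varphi_I(X)$: there is a vertex outside $X$ adjacent to every vertex of $X$. Then $\varphi^1_C=\forall X[\mathrm{cl}(X)\to\varphi_C(X)]$, $\varphi^2_C=\forall X[\max\mathrm{cl}(X)\to\neg\varphi_C(X)]$, $\varphi^3_C=\forall X[(\mathrm{cl}(X)\wedge\neg\varphi_C(X))\to\max\mathrm{cl}(X)]$, and $\varphi^1_I=\forall X[\mathrm{ind}(X)\to\varphi_I(X)]$, $\varphi^2_I=\forall X[\max\mathrm{ind}(X)\to\neg\varphi_I(X)]$, $\varphi^3_I=\forall X[(\mathrm{ind}(X)\wedge\neg\varphi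_I(X))\to\max\mathrm{ind}(X)]$.
   Formalization: The s-extension property additionally requires at least s vertices, since otherwise smaller graphs have it vacuously and (i) fails (e.g. the empty graph and the one-vertex graph); finite graphs are taken with vertices among the natural numbers. *)

theory Defs
  imports Main
begin

section \<open>Finite simple graphs (vertices drawn from nat; every finite graph is isomorphic to one of these)\<close>

record graph =
  verts :: "nat set"
  adj :: "nat \<Rightarrow> nat \<Rightarrow> bool"

definition is_graph :: "graph \<Rightarrow> bool" where
  "is_graph G \<longleftrightarrow> finite (verts G)
     \<and> (\<forall>u v. adj G u v \<longrightarrow> u \<in> verts G \<and> v \<in> verts G)
     \<and> (\<forall>u v. adj G u v \<longrightarrow> adj G v u)
     \<and> (\<forall>u. \<not> adj G u u)"

definition ext_prop :: "nat \<Rightarrow> graph \<Rightarrow> bool" where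
  "ext_prop s G \<longleftrightarrow> s \<le> card (verts G) \<and>
     (\<forall>S T. S \<subseteq> verts G \<longrightarrow> card S = s \<longrightarrow> T \<subseteq> S \<longrightarrow>
        (\<exists>z \<in> verts G. z \<notin> S \<and> (\<forall>t\<in>T. adj G z t) \<and> (\<forall>u\<in>S - T. \<not> adj G z u)))"

datatype fo =
    Adj nat nat
  | Eq nat nat
  | InX nat
  | Neg fo
  | Conj fo fo
  | Ex nat fo

fun fv :: "fo \<Rightarrow> nat set" where
  "fv (Adj x y) = {x, y}"
| "fv (Eq x y) = {x, y}"
| "fv (InX x) = {x}"
| "fv (Neg f) = fv f"
| "fv (Conj f g) = fv f \<union> fv g"
| "fv (Ex x f) = fv f - {x}"

fun qdepth :: "fo \<Rightarrow> nat" where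
  "qdepth (Adj x y) = 0"
| "qdepth (Eq x y) = 0"
| "qdepth (InX x) = 0"
| "qdepth (Neg f) = qdepth f"
| "qdepth (Conj f g) = max (qdepth f) (qdepth g)"
| "qdepth (Ex x f) = Suc (qdepth f)"

fun sat :: "graph \<Rightarrow> nat set \<Rightarrow> (nat \<Rightarrow> nat) \<Rightarrow> fo \<Rightarrow> bool" where
  "sat G X e (Adj x y) = adj G (e x) (e y)"
| "sat G X e (Eq x y) = (e x = e y)"
| "sat G X e (InX x) = (e x \<in> X)"
| "sat G X e (Neg f) = (\<not> sat G X e f)"
| "sat G X e (Conj f g) = (sat G X e f \<and> sat G X e g)"
| "sat G X e (Ex x f) = (\<exists>v \<in> verts G. sat G X (e(x := v)) f)"

text \<open>The class E_1^2: sentences EX X. phi(X), phi first order of quantifier depth (at most) 2.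
  We represent such a sentence by its first-order matrix phi.\<close>
definition E12 :: "fo \<Rightarrow> bool" where
  "E12 \<phi> \<longleftrightarrow> fv \<phi> = {} \<and> qdepth \<phi> \<le> 2"

definition holds_E12 :: "graph \<Rightarrow> fo \<Rightarrow> bool" where
  "holds_E12 G \<phi> \<longleftrightarrow> (\<exists>X \<subseteq> verts G. sat G X (\<lambda>_. 0) \<phi>)"

definition cl :: "graph \<Rightarrow> nat set \<Rightarrow> bool" where
  "cl G X \<longleftrightarrow> (\<forall>x\<in>X. \<forall>y\<in>X. x \<noteq> y \<longrightarrow> adj G x y)"

definition maxcl :: "graph \<Rightarrow> nat set \<Rightarrow> bool" where
  "maxcl G X \<longleftrightarrow> cl G X \<and> \<not> (\<exists>z \<in> verts G - X. \<forall>x\<in>X. adj G z x)"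

definition phiC :: "graph \<Rightarrow> nat set \<Rightarrow> bool" where
  "phiC G X \<longleftrightarrow> (\<exists>z \<in> verts G - X. \<forall>x\<in>X. \<not> adj G z x)"

definition ind :: "graph \<Rightarrow> nat set \<Rightarrow> bool" where
  "ind G X \<longleftrightarrow> (\<forall>x\<in>X. \<forall>y\<in>X. \<not> adj G x y)"

definition maxind :: "graph \<Rightarrow> nat set \<Rightarrow> bool" where
  "maxind G X \<longleftrightarrow> ind G X \<and> \<not> (\<exists>z \<in> verts G - X. \<forall>x\<in>X. \<not> adj G z x)"

definition phiI :: "graph \<Rightarrow> nat set \<Rightarrow> bool" where
  "phiI G X \<longleftrightarrow> (\<exists>z \<in> verts G - X. \<forall>x\<in>X. adj G z x)"

definition phiC1 :: "graph \<Rightarrow> bool" where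
  "phiC1 G \<longleftrightarrow> (\<forall>X \<subseteq> verts G. cl G X \<longrightarrow> phiC G X)"
definition phiC2 :: "graph \<Rightarrow> bool" where
  "phiC2 G \<longleftrightarrow> (\<forall>X \<subseteq> verts G. maxcl G X \<longrightarrow> \<not> phiC G X)"
definition phiC3 :: "graph \<Rightarrow> bool" where
  "phiC3 G \<longleftrightarrow> (\<forall>X \<subseteq> verts G. (cl G X \<and> \<not> phiC G X) \<longrightarrow> maxcl G X)"

definition phiI1 :: "graph \<Rightarrow> bool" where
  "phiI1 G \<longleftrightarrow> (\<forall>X \<subseteq> verts G. ind G X \<longrightarrow> phiI G X)"
definition phiI2 :: "graph \<Rightarrow> bool" where
  "phiI2 G \<longleftrightarrow> (\<forall>X \<subseteq> verts G. maxind G X \<longrightarrow> \<not> phiI G X)"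
definition phiI3 :: "graph \<Rightarrow> bool" where
  "phiI3 G \<longleftrightarrow> (\<forall>X \<subseteq> verts G. (ind G X \<and> \<not> phiI G X) \<longrightarrow> maxind G X)"

end

theory Submission
  imports Defs Complex_Main
begin

text \<open>
  For (i): a sentence of depth two on \<open>(G, X)\<close> only sees which vertex types occur, where the type of \<open>v\<close> records
  whether \<open>v \<in> X\<close> and whether \<open>v\<close> has neighbours and non-neighbours in \<open>X\<close> and outside \<open>X\<close>. Under the extension
  property a vertex that is not mixed towards \<open>X\<close> forces all other vertices to be mixed towards the complement
  of \<open>X\<close>. Up to exchanging \<open>X\<close> with its complement this leaves a short list of type sets, each of which is
  realised in every graph with the extension property, except for those of cliques and independent sets \<open>X\<close>;
  these are exactly what the six sentences decide.

  For (ii): a generic multipartite graph, obtained by counting, supplies the extension property, and a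
  frame of auxiliary vertices attached to it controls which cliques are maximal or dominating
  (no outside vertex is non-adjacent to all of the clique). Complement graphs exchange the two families.
\<close>

text \<open>Six sentences suffice because the type set of a clique with at least two elements is
  fixed by two bits: whether it is maximal and whether it dominates. A clique with neither property
  always exists, namely an edge. A maximal non-dominating clique exists iff \<open>phiC2\<close>
  fails, a dominating non-maximal one iff \<open>phiC3\<close> fails, and one with both properties
  iff \<open>phiC1\<close> fails, since a dominating clique stays dominating when enlarged.

  The obstacle in (ii) is that the sentences quantify over cliques of every size, while an extension
  property controls only a bounded number of vertices. In the multipartite set a clique has at most
  one vertex in each part, so its whole trace there can be handled by one application of genericity.
  Large cliques can then only come from the frame, where the permitted neighbourhoods are chosen by
  hand. Taking more parts than \<open>s\<close> leaves a part that the vertices of a given instance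
  of the extension property do not use.\<close>

text \<open>The value \<open>(True, False)\<close> means \<open>v\<close> is adjacent to all other vertices of \<open>A\<close>,
  \<open>(False, True)\<close> to none of them, \<open>(True, True)\<close> that it is mixed, and \<open>(False, False)\<close> that \<open>A\<close> has
  no vertex other than \<open>v\<close>.\<close>

definition nbr_status :: "graph \<Rightarrow> nat set \<Rightarrow> nat \<Rightarrow> bool \<times> bool" where
  "nbr_status G A v = ((\<exists>u\<in>A. u \<noteq> v \<and> adj G v u), (\<exists>u\<in>A. u \<noteq> v \<and> \<not> adj G v u))"

definition vtype :: "graph \<Rightarrow> nat set \<Rightarrow> nat \<Rightarrow> bool \<times> (bool \<times> bool) \<times> (bool \<times> bool)" where
  "vtype G X v = (v \<in> X, nbr_status G X v, nbr_status G (verts G - X) v)"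

definition vtypes :: "graph \<Rightarrow> nat set \<Rightarrow> (bool \<times> (bool \<times> bool) \<times> (bool \<times> bool)) set" where
  "vtypes G X = vtype G X ` verts G"

lemma is_graph_irrefl: "is_graph G \<Longrightarrow> \<not> adj G v v"
  and is_graph_sym: "is_graph G \<Longrightarrow> adj G u v \<longleftrightarrow> adj G v u"
  and is_graph_finite: "is_graph G \<Longrightarrow> finite (verts G)"
  and is_graph_adj_verts: "is_graph G \<Longrightarrow> adj G u v \<Longrightarrow> u \<in> verts G \<and> v \<in> verts G"
  unfolding is_graph_def by blast+

section \<open>Sentences of quantifier depth two\<close>

lemma sat_cong_depth0:
  assumes "qdepth f = 0"
    and "\<forall>x\<in>fv f. e x \<in> X \<longleftrightarrow> e' x \<in> X'"
    and "\<forall>x\<in>fv f. \<forall>y\<in>fv f. (adj G (e x) (e y) \<longleftrightarrow> adj H (e' x) (e' y)) \<and> (e x = e y \<longleftrightarrow> e' x = e' y)"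
  shows "sat G X e f \<longleftrightarrow> sat H X' e' f"
  using assms by (induction f) auto

text \<open>This is the second round of the pebble game. Once \<open>u\<close> and \<open>u'\<close>
  are fixed, a further vertex shows only its side, equality and adjacency, and the status towards
  that side records which combinations occur.\<close>

lemma vtype_eq_forth:
  assumes G: "is_graph G" and H: "is_graph H" and X: "X \<subseteq> verts G" "X' \<subseteq> verts H"
    and uu': "u' \<in> verts H" and ty: "vtype G X u = vtype H X' u'" and v: "v \<in> verts G"
  shows "\<exists>v'\<in>verts H. (v \<in> X \<longleftrightarrow> v' \<in> X') \<and> (v = u \<longleftrightarrow> v' = u') \<and> (adj G u v \<longleftrightarrow> adj H u' v')"
proof (cases "v = u")
  case True
  with ty uu' show ?thesis
    by (auto simp: vtype_def is_graph_irrefl[OF G] is_graph_irrefl[OF H] intro!: bexI[of _ u'])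
next
  case False
  define A where "A = (if v \<in> X then X else verts G - X)"
  define A' where "A' = (if v \<in> X then X' else verts H - X')"
  have st: "nbr_status G A u = nbr_status H A' u'"
    using ty by (auto simp: vtype_def A_def A'_def)
  have vA: "v \<in> A" using v by (auto simp: A_def)
  obtain v' where "v' \<in> A'" "v' \<noteq> u'" "adj G u v \<longleftrightarrow> adj H u' v'"
  proof (cases "adj G u v")
    case True
    with st vA False show ?thesis using that by (auto simp: nbr_status_def)
  next
    case nadj: False
    with st vA False show ?thesis using that by (auto simp: nbr_status_def)
  qed
  with False X show ?thesis by (intro bexI[of _ v']) (auto simp: A'_def split: if_splits)
qed

text \<open>A quantifier is answered by a vertex with the same relation to \<open>x\<close>. The
  quantifier may also rebind \<open>x\<close>; therefore the assignments are compared after the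
  update, and only on \<open>{x, y}\<close>.\<close>

lemma sat_cong_depth1:
  assumes G: "is_graph G" and H: "is_graph H" and X: "X \<subseteq> verts G" "X' \<subseteq> verts H"
    and "qdepth f \<le> 1" "fv f \<subseteq> {x}" and ex: "e x \<in> verts G" "e' x \<in> verts H"
    and ty: "vtype G X (e x) = vtype H X' (e' x)"
  shows "sat G X e f \<longleftrightarrow> sat H X' e' f"
  using assms(5,6)
proof (induction f)
  case (Ex y g)
  then have g: "qdepth g = 0" "fv g \<subseteq> {x, y}" by auto
  have step: "sat G X (e(y := v)) g \<longleftrightarrow> sat H X' (e'(y := v')) g"
    if "v \<in> X \<longleftrightarrow> v' \<in> X'" "v = e x \<longleftrightarrow> v' = e' x" "adj G (e x) v \<longleftrightarrow> adj H (e' x) v'" for v v'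
  proof (rule sat_cong_depth0[OF g(1)])
    have "e x \<in> X \<longleftrightarrow> e' x \<in> X'" using ty by (auto simp: vtype_def)
    then show "\<forall>z\<in>fv g. (e(y := v)) z \<in> X \<longleftrightarrow> (e'(y := v')) z \<in> X'"
      using g(2) that by auto
    show "\<forall>z\<in>fv g. \<forall>z'\<in>fv g.
       (adj G ((e(y := v)) z) ((e(y := v)) z') \<longleftrightarrow> adj H ((e'(y := v')) z) ((e'(y := v')) z')) \<and>
       ((e(y := v)) z = (e(y := v)) z' \<longleftrightarrow> (e'(y := v')) z = (e'(y := v')) z')"
    proof (intro ballI)
      fix z z' assume "z \<in> fv g" "z' \<in> fv g"
      with g(2) have "z = y \<or> z = x" "z' = y \<or> z' = x" by auto
      moreover have "adj G v (e x) \<longleftrightarrow> adj H v' (e' x)"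
        using that(3) is_graph_sym[OF G] is_graph_sym[OF H] by blast
      ultimately show "(adj G ((e(y := v)) z) ((e(y := v)) z') \<longleftrightarrow> adj H ((e'(y := v')) z) ((e'(y := v')) z')) \<and>
       ((e(y := v)) z = (e(y := v)) z' \<longleftrightarrow> (e'(y := v')) z = (e'(y := v')) z')"
        using that(2,3) by (elim disjE) (simp_all add: is_graph_irrefl[OF G] is_graph_irrefl[OF H], metis+)
    qed
  qed
  show ?case
  proof
    assume "sat G X e (Ex y g)"
    then obtain v where v: "v \<in> verts G" "sat G X (e(y := v)) g" by auto
    from vtype_eq_forth[OF G H X ex(2) ty v(1)] step v(2)
    show "sat H X' e' (Ex y g)" by auto
  next
    assume "sat H X' e' (Ex y g)"
    then obtain v' where v: "v' \<in> verts H" "sat H X' (e'(y := v')) g" by auto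
    from vtype_eq_forth[OF H G X(2,1) ex(1) ty[symmetric] v(1)]
    obtain v where "v \<in> verts G" "v' \<in> X' \<longleftrightarrow> v \<in> X" "v' = e' x \<longleftrightarrow> v = e x"
      "adj H (e' x) v' \<longleftrightarrow> adj G (e x) v" by auto
    with step[of v v'] v(2) show "sat G X e (Ex y g)" by auto
  qed
next
  case (Adj y z)
  then show ?case by (auto simp: is_graph_irrefl[OF G] is_graph_irrefl[OF H])
next
  case (InX y)
  then show ?case using ty by (auto simp: vtype_def)
qed auto

lemma sat_cong_depth2:
  assumes G: "is_graph G" and H: "is_graph H" and X: "X \<subseteq> verts G" "X' \<subseteq> verts H"
    and "qdepth f \<le> 2" "fv f = {}" and ty: "vtypes G X = vtypes H X'"
  shows "sat G X e f \<longleftrightarrow> sat H X' e' f"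
  using assms(5,6)
proof (induction f)
  case (Ex y g)
  then have g: "qdepth g \<le> 1" "fv g \<subseteq> {y}" by auto
  have step: "sat G X (e(y := v)) g \<longleftrightarrow> sat H X' (e'(y := v')) g"
    if "v \<in> verts G" "v' \<in> verts H" "vtype G X v = vtype H X' v'" for v v'
    by (rule sat_cong_depth1[OF G H X g]) (use that in auto)
  have "\<forall>v\<in>verts G. \<exists>v'\<in>verts H. vtype G X v = vtype H X' v'"
    using ty unfolding vtypes_def by (metis imageE imageI)
  moreover have "\<forall>v'\<in>verts H. \<exists>v\<in>verts G. vtype G X v = vtype H X' v'"
    using ty unfolding vtypes_def by (metis imageE imageI)
  ultimately show ?case using step by (auto, blast+)
qed auto

section \<open>Complements\<close>

lemma vtypes_compl_set:
  assumes "X \<subseteq> verts G"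
  shows "vtypes G (verts G - X) = (\<lambda>(b, p, q). (\<not> b, q, p)) ` vtypes G X"
proof -
  have "verts G - (verts G - X) = X" using assms by auto
  then have "\<And>v. v \<in> verts G \<Longrightarrow> vtype G (verts G - X) v = (\<lambda>(b, p, q). (\<not> b, q, p)) (vtype G X v)"
    by (simp add: vtype_def)
  then show ?thesis unfolding vtypes_def image_image by (rule image_cong[OF refl])
qed

definition gcompl :: "graph \<Rightarrow> graph" where
  "gcompl G = \<lparr>verts = verts G,
     adj = (\<lambda>u v. u \<in> verts G \<and> v \<in> verts G \<and> u \<noteq> v \<and> \<not> adj G u v)\<rparr>"

lemma verts_gcompl [simp]: "verts (gcompl G) = verts G"
  by (simp add: gcompl_def)

lemma adj_gcompl:
  "u \<in> verts G \<Longrightarrow> v \<in> verts G \<Longrightarrow> adj (gcompl G) u v \<longleftrightarrow> u \<noteq> v \<and> \<not> adj G u v"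
  by (simp add: gcompl_def)

lemma is_graph_gcompl: "is_graph G \<Longrightarrow> is_graph (gcompl G)"
  unfolding is_graph_def by (auto simp: gcompl_def)

lemma ext_prop_gcompl:
  assumes "ext_prop s G"
  shows "ext_prop s (gcompl G)"
  unfolding ext_prop_def
proof (intro conjI allI impI)
  show "s \<le> card (verts (gcompl G))" using assms by (simp add: ext_prop_def)
  fix S T assume S: "S \<subseteq> verts (gcompl G)" "card S = s" "T \<subseteq> S"
  then obtain z where "z \<in> verts G" "z \<notin> S" "\<forall>t\<in>S - T. adj G z t" "\<forall>u\<in>S - (S - T). \<not> adj G z u"
    using assms unfolding ext_prop_def by (metis Diff_subset verts_gcompl)
  with S show "\<exists>z\<in>verts (gcompl G). z \<notin> S \<and> (\<forall>t\<in>T. adj (gcompl G) z t) \<and> (\<forall>u\<in>S - T. \<not> adj (gcompl G) z u)"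
    by (intro bexI[of _ z]) (auto simp: gcompl_def)
qed

lemma cl_gcompl: "is_graph G \<Longrightarrow> X \<subseteq> verts G \<Longrightarrow> cl (gcompl G) X \<longleftrightarrow> ind G X"
  unfolding cl_def ind_def using is_graph_irrefl[of G] by (metis adj_gcompl subsetD)

lemma phiC_gcompl: "X \<subseteq> verts G \<Longrightarrow> phiC (gcompl G) X \<longleftrightarrow> phiI G X"
  unfolding phiC_def phiI_def by (intro bex_cong ball_cong refl) (auto simp: adj_gcompl)

lemma maxcl_gcompl: "is_graph G \<Longrightarrow> X \<subseteq> verts G \<Longrightarrow> maxcl (gcompl G) X \<longleftrightarrow> maxind G X"
  unfolding maxcl_def maxind_def 
  by (intro conj_cong arg_cong[of _ _ Not] bex_cong ball_cong refl) (auto simp: adj_gcompl cl_gcompl)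

lemma phiC123_gcompl:
  assumes "is_graph G"
  shows "phiC1 (gcompl G) \<longleftrightarrow> phiI1 G" "phiC2 (gcompl G) \<longleftrightarrow> phiI2 G" "phiC3 (gcompl G) \<longleftrightarrow> phiI3 G"
  using assms unfolding phiC1_def phiI1_def phiC2_def phiI2_def phiC3_def phiI3_def
  by (auto simp: cl_gcompl maxcl_gcompl phiC_gcompl)

text \<open>A literal equality, not just an isomorphism: \<open>is_graph\<close> confines
  \<open>adj\<close> to pairs of distinct vertices, as \<open>gcompl\<close> does. Facts about
  cliques can thus be carried to independent sets and back.\<close>

lemma gcompl_gcompl: "is_graph G \<Longrightarrow> gcompl (gcompl G) = G"
  unfolding gcompl_def using is_graph_adj_verts[of G] is_graph_irrefl[of G]
  by (intro graph.equality ext) auto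

lemma phiI123_gcompl:
  assumes "is_graph G"
  shows "phiI1 (gcompl G) \<longleftrightarrow> phiC1 G" "phiI2 (gcompl G) \<longleftrightarrow> phiC2 G" "phiI3 (gcompl G) \<longleftrightarrow> phiC3 G"
  using phiC123_gcompl[OF is_graph_gcompl[OF assms]] gcompl_gcompl[OF assms] by auto

text \<open>A status never looks at \<open>v\<close> itself, so complementation just exchanges its
  two components.\<close>

lemma vtypes_gcompl:
  assumes "X \<subseteq> verts G"
  shows "vtypes (gcompl G) X = (\<lambda>(b, p, q). (b, prod.swap p, prod.swap q)) ` vtypes G X"
proof -
  have "nbr_status (gcompl G) A v = prod.swap (nbr_status G A v)" if "A \<subseteq> verts G" "v \<in> verts G" for A v
    using that unfolding nbr_status_def by (auto simp: gcompl_def)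
  then have "vtype (gcompl G) X v = (\<lambda>(b, p, q). (b, prod.swap p, prod.swap q)) (vtype G X v)"
    if "v \<in> verts G" for v
    using that assms by (simp add: vtype_def)
  then show ?thesis unfolding vtypes_def image_image verts_gcompl by (rule image_cong[OF refl])
qed

section \<open>Vertex types under the extension property\<close>

text \<open>Six is the number of vertices constrained simultaneously in \<open>vtypes_realize\<close>.\<close>

locale ext_graph =
  fixes G :: graph
  assumes graph: "is_graph G" and ext: "ext_prop 6 G"
begin

lemmas irrefl = is_graph_irrefl[OF graph]
lemmas adj_sym = is_graph_sym[OF graph]
lemmas fin = is_graph_finite[OF graph]

text \<open>Shorter lists are padded to the six vertices of the extension property. Only
  \<open>set xs\<close> matters, so entries may coincide, which spares case splits such as
  \<open>u = v\<close>.\<close>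

lemma witness:
  assumes "set xs \<subseteq> verts G" "length xs \<le> 6"
  shows "\<exists>z\<in>verts G - set xs. \<forall>x\<in>set xs. adj G z x \<longleftrightarrow> \<pi> x"
proof -
  have "card (set xs) \<le> 6" using assms(2) card_length[of xs] by linarith
  moreover have "6 \<le> card (verts G)" using ext by (simp add: ext_prop_def)
  ultimately obtain S where S: "set xs \<subseteq> S" "S \<subseteq> verts G" "card S = 6"
    using exists_subset_between[OF _ _ assms(1) fin] by blast
  define T where "T = {x\<in>set xs. \<pi> x}"
  have "T \<subseteq> S" using S by (auto simp: T_def)
  with ext S obtain z where "z \<in> verts G" "z \<notin> S" "\<forall>t\<in>T. adj G z t" "\<forall>u\<in>S - T. \<not> adj G z u"
    unfolding ext_prop_def by blast
  with S show ?thesis by (intro bexI[of _ z]) (auto simp: T_def)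
qed

lemma ex_vert: "\<exists>v. v \<in> verts G"
  using witness[of "[]"] by auto

lemma status_verts: "v \<in> verts G \<Longrightarrow> nbr_status G (verts G) v = (True, True)"
  using witness[of "[v]" "\<lambda>_. True"] witness[of "[v]" "\<lambda>_. False"] adj_sym[of v]
  unfolding nbr_status_def by auto

lemma vtypes_empty: "vtypes G {} = {(False, (False, False), (True, True))}"
proof -
  have "vtype G {} v = (False, (False, False), (True, True))" if "v \<in> verts G" for v
    using status_verts[OF that] by (simp add: vtype_def) (simp add: nbr_status_def)
  then show ?thesis using ex_vert unfolding vtypes_def by force
qed

lemma vtypes_singleton:
  assumes v: "v \<in> verts G"
  shows "vtypes G {v} = {(True, (False, False), (True, True)),
     (False, (True, False), (True, True)), (False, (False, True), (True, True))}"
proof -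
  have rest: "nbr_status G (verts G - {v}) u = (True, True)" if "u \<in> verts G" for u
    using witness[of "[u, v]" "\<lambda>_. True"] witness[of "[u, v]" "\<lambda>_. False"] adj_sym[of u] v that
    unfolding nbr_status_def by auto
  have ty: "vtype G {v} u = (u = v, (u \<noteq> v \<and> adj G u v, u \<noteq> v \<and> \<not> adj G u v), (True, True))"
    if "u \<in> verts G" for u
    using rest[OF that] by (auto simp: vtype_def) (auto simp: nbr_status_def)
  obtain a b where ab: "a \<in> verts G" "a \<noteq> v" "adj G a v" "b \<in> verts G" "b \<noteq> v" "\<not> adj G b v"
    using witness[of "[v]" "\<lambda>_. True"] witness[of "[v]" "\<lambda>_. False"] v by auto
  show ?thesis
  proof
    show "vtypes G {v} \<subseteq> {(True, (False, False), (True, True)),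
     (False, (True, False), (True, True)), (False, (False, True), (True, True))}"
      unfolding vtypes_def using ty by auto
    have "{vtype G {v} v, vtype G {v} a, vtype G {v} b} \<subseteq> vtypes G {v}"
      using ab v unfolding vtypes_def by blast
    then show "{(True, (False, False), (True, True)),
     (False, (True, False), (True, True)), (False, (False, True), (True, True))} \<subseteq> vtypes G {v}"
      using ab v ty by auto
  qed
qed

text \<open>Realises a vertex \<open>u\<close> that is non-mixed towards both sides, joined to all
  of \<open>X\<close> and to nothing else. Such an \<open>X\<close> is the neighbourhood of
  \<open>u\<close>, and \<open>c\<close> decides on which side \<open>u\<close> itself lies.\<close>

lemma vtypes_nbhd:
  assumes u: "u \<in> verts G"
  shows "\<exists>X\<subseteq>verts G. vtypes G X =
     {(c, (True, False), (False, True)), (True, (True, True), (True, True)), (False, (True, True), (True, True))}"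
proof -
  define X where "X = {x\<in>verts G. adj G u x} \<union> (if c then {u} else {})"
  have XV: "X \<subseteq> verts G" using u by (auto simp: X_def)
  obtain a b where ab: "a \<in> verts G" "a \<noteq> u" "adj G a u" "b \<in> verts G" "b \<noteq> u" "\<not> adj G b u"
    using witness[of "[u]" "\<lambda>_. True"] witness[of "[u]" "\<lambda>_. False"] u by auto
  have hit: "\<exists>x\<in>verts G. x \<noteq> u \<and> x \<noteq> v \<and> (adj G v x \<longleftrightarrow> p) \<and> (adj G u x \<longleftrightarrow> q)"
    if "v \<in> verts G" "v \<noteq> u" for v p q
    using witness[of "[u, v]" "\<lambda>x. if x = u then q else p"] that u adj_sym by fastforce
  have tyu: "vtype G X u = (c, (True, False), (False, True))"
    using ab adj_sym[of u] irrefl unfolding vtype_def nbr_status_def X_def by auto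
  have tyv: "vtype G X v = (v \<in> X, (True, True), (True, True))" if "v \<in> verts G" "v \<noteq> u" for v
    using hit[OF that, of True True] hit[OF that, of True False]
      hit[OF that, of False True] hit[OF that, of False False]
    unfolding vtype_def nbr_status_def X_def by auto
  have inX: "a \<in> X" "b \<notin> X" using ab adj_sym[of u] by (auto simp: X_def)
  have "vtypes G X = {(c, (True, False), (False, True)), (True, (True, True), (True, True)),
      (False, (True, True), (True, True))}" (is "_ = ?R")
  proof
    show "vtypes G X \<subseteq> ?R"
    proof
      fix y assume "y \<in> vtypes G X"
      then obtain v where v: "v \<in> verts G" "y = vtype G X v" by (auto simp: vtypes_def)
      then show "y \<in> ?R" using tyu tyv[of v] by (cases "v = u") auto
    qed
    have "{vtype G X u, vtype G X a, vtype G X b} \<subseteq> vtypes G X"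
      using ab u unfolding vtypes_def by blast
    then show "?R \<subseteq> vtypes G X" using tyu tyv ab inX by auto
  qed
  with XV show ?thesis by blast
qed


text \<open>Every vertex is mixed towards the complement, so only the statuses of outside vertices
  towards \<open>X\<close> vary: a mixed one always exists, one joined to all of \<open>X\<close>
  means non-maximality, one joined to none means \<open>phiC\<close>.\<close>

lemma vtypes_clique:
  assumes X: "X \<subseteq> verts G" "cl G X" and x: "x1 \<in> X" "x2 \<in> X" "x1 \<noteq> x2"
  shows "vtypes G X = {(True, (True, False), (True, True)), (False, (True, True), (True, True))}
     \<union> (if maxcl G X then {} else {(False, (True, False), (True, True))})
     \<union> (if phiC G X then {(False, (False, True), (True, True))} else {})" (is "_ = ?R")
proof -
  have xV: "x1 \<in> verts G" "x2 \<in> verts G" using X x by auto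
  have out: "\<exists>y\<in>verts G - X. y \<noteq> v \<and> (adj G v y \<longleftrightarrow> p)" if v: "v \<in> verts G" for v p
  proof -
    \<comment> \<open>Any other vertex not adjacent to \<open>x\<close> lies outside the clique, so
      \<open>y\<close> can be kept out of \<open>X\<close> while its adjacency to \<open>v\<close>
      stays free.\<close>
    obtain x where xx: "x \<in> X" "x \<noteq> v" using x by metis
    then have "x \<in> verts G" using X by auto
    then obtain y where y: "y \<in> verts G" "y \<noteq> x" "y \<noteq> v" "\<not> adj G y x" "adj G y v \<longleftrightarrow> p"
      using witness[of "[x, v]" "\<lambda>u. u = v \<and> p"] v xx by auto
    then have "y \<notin> X" using X(2) xx(1) unfolding cl_def by blast
    then show ?thesis using y adj_sym by blast
  qed
  have Y: "nbr_status G (verts G - X) v = (True, True)" if "v \<in> verts G" for v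
    using out[OF that, of True] out[OF that, of False] unfolding nbr_status_def by blast
  have in_X: "vtype G X v = (True, (True, False), (True, True))" if "v \<in> X" for v
  proof -
    have "\<exists>u\<in>X. u \<noteq> v" using x by metis
    then have "nbr_status G X v = (True, False)"
      using X(2) that by (fastforce simp: nbr_status_def cl_def)
    with that X(1) Y[of v] show ?thesis by (auto simp: vtype_def)
  qed
  have nX: "vtype G X v = (False, ((\<exists>u\<in>X. adj G v u), (\<exists>u\<in>X. \<not> adj G v u)), (True, True))"
    if "v \<in> verts G - X" for v
    using that Y[of v] unfolding vtype_def by (auto simp: nbr_status_def)
  have max: "maxcl G X \<longleftrightarrow> \<not> (\<exists>v\<in>verts G - X. \<forall>u\<in>X. adj G v u)"
    using X(2) by (simp add: maxcl_def)
  obtain y where y: "y \<in> verts G" "y \<noteq> x1" "y \<noteq> x2" "adj G y x1" "\<not> adj G y x2"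
    using witness[of "[x1, x2]" "\<lambda>u. u = x1"] xV x by auto
  then have ynX: "y \<in> verts G - X" using X(2) x unfolding cl_def by blast
  have ty: "vtype G X y = (False, (True, True), (True, True))"
    using nX[OF ynX] x y by auto
  show ?thesis
  proof (intro equalityI subsetI)
    fix z assume "z \<in> vtypes G X"
    then obtain v where v: "v \<in> verts G" "z = vtype G X v" by (auto simp: vtypes_def)
    show "z \<in> ?R"
    proof (cases "v \<in> X")
      case True
      then show ?thesis using in_X v by simp
    next
      case False
      then have vX: "v \<in> verts G - X" using v by auto
      have "\<exists>u. u \<in> X" using x by auto
      then consider "\<forall>u\<in>X. adj G v u" "\<exists>u\<in>X. adj G v u" | "\<forall>u\<in>X. \<not> adj G v u" "\<exists>u\<in>X. \<not> adj G v u"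
        | "\<exists>u\<in>X. adj G v u" "\<exists>u\<in>X. \<not> adj G v u" by blast
      then show ?thesis
      proof cases
        case 1
        then have "\<not> maxcl G X" using max vX by blast
        moreover have "z = (False, (True, False), (True, True))" using nX[OF vX] 1 v by auto
        ultimately show ?thesis by simp
      next
        case 2
        then have "phiC G X" using vX unfolding phiC_def by blast
        moreover have "z = (False, (False, True), (True, True))" using nX[OF vX] 2 v by auto
        ultimately show ?thesis by simp
      next
        case 3
        then show ?thesis using nX[OF vX] v by auto
      qed
    qed
  next
    fix z assume "z \<in> ?R"
    then consider "z = (True, (True, False), (True, True))" | "z = (False, (True, True), (True, True))"
      | "\<not> maxcl G X" "z = (False, (True, False), (True, True))"
      | "phiC G X" "z = (False, (False, True), (True, True))" by (auto split: if_splits)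
    then have "\<exists>v\<in>verts G. z = vtype G X v"
    proof cases
      case 1
      then show ?thesis using in_X[OF x(1)] xV by metis
    next
      case 2
      then show ?thesis using ty y by metis
    next
      case 3
      then obtain v where v: "v \<in> verts G - X" "\<forall>u\<in>X. adj G v u" using max by blast
      then have "z = vtype G X v" using 3 nX[OF v(1)] x by auto
      then show ?thesis using v by blast
    next
      case 4
      then obtain v where v: "v \<in> verts G - X" "\<forall>u\<in>X. \<not> adj G v u" unfolding phiC_def by blast
      then have "z = vtype G X v" using 4 nX[OF v(1)] x by auto
      then show ?thesis using v by blast
    qed
    then show "z \<in> vtypes G X" by (auto simp: vtypes_def)
  qed
qed

text \<open>The vertices \<open>u\<close>, \<open>w\<close>, \<open>w'\<close> carry the prescribed non-mixed types; the condition of being adjacent to \<open>a\<close>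
  keeps the complement of \<open>X\<close> rich, and the exceptional vertex \<open>b\<close> keeps \<open>a\<close> itself mixed.\<close>

lemma vtypes_realize:
  fixes p :: "bool option" and d n :: bool
  shows "\<exists>X\<subseteq>verts G. vtypes G X = {(True, (True, True), (True, True)), (False, (True, True), (True, True))}
     \<union> (case p of None \<Rightarrow> {} | Some c \<Rightarrow> {(True, (c, \<not> c), (True, True))})
     \<union> (if d then {(False, (True, False), (True, True))} else {})
     \<union> (if n then {(False, (False, True), (True, True))} else {})" (is "\<exists>X\<subseteq>_. _ = ?R")
proof -
  obtain u where u: "u \<in> verts G" using ex_vert by blast
  obtain w where w: "w \<in> verts G" "w \<noteq> u" "adj G w u"
    using witness[of "[u]" "\<lambda>_. True"] u by auto
  obtain w' where w': "w' \<in> verts G" "w' \<noteq> u" "w' \<noteq> w" "\<not> adj G w' u"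
    using witness[of "[u, w]" "\<lambda>_. False"] u w by auto
  \<comment> \<open>\<open>b\<close> will lie in \<open>X\<close>, so it already meets the demands
    that \<open>u\<close>, \<open>w\<close> and \<open>w'\<close> make on the members of
    \<open>X\<close>.\<close>
  obtain b where b: "b \<in> verts G" "b \<noteq> u" "b \<noteq> w" "b \<noteq> w'"
      "adj G b w" "\<not> adj G b w'" "adj G b u \<longleftrightarrow> p = Some True"
    using witness[of "[u, w, w']" "\<lambda>x. x = w \<or> x = u \<and> p = Some True"] u w w' by auto
  \<comment> \<open>Apart from \<open>b\<close> and \<open>u\<close>, all members of
    \<open>X\<close> will be neighbours of \<open>a\<close>, so any other non-neighbour of
    \<open>a\<close> is outside. The edge to \<open>w\<close> gives \<open>a\<close> itself a
    neighbour outside.\<close>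
  obtain a where a: "a \<in> verts G" "a \<noteq> u" "a \<noteq> w" "a \<noteq> w'" "a \<noteq> b" "\<not> adj G a b" "adj G a w"
    using witness[of "[u, w, w', b]" "\<lambda>x. x = w"] u w w' b by auto
  define X0 where "X0 = {x \<in> verts G - {u, w, w', a, b}. adj G x a \<and> (\<forall>c. p = Some c \<longrightarrow> (adj G x u \<longleftrightarrow> c))
      \<and> (d \<longrightarrow> adj G x w) \<and> (n \<longrightarrow> \<not> adj G x w')}"
  define X where "X = X0 \<union> {b} \<union> (if p = None then {} else {u})"
  have XV: "X \<subseteq> verts G" using u b by (auto simp: X_def X0_def)
  have mem: "a \<notin> X" "w \<notin> X" "w' \<notin> X" "b \<in> X" "u \<in> X \<longleftrightarrow> p \<noteq> None"
    using a u w w' b by (auto simp: X_def X0_def)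
  have hit0: "\<exists>x\<in>X0. x \<noteq> v \<and> (adj G v x \<longleftrightarrow> \<beta>)"
    if v: "v \<in> verts G" and c: "v = a \<longrightarrow> \<beta>" "v = u \<longrightarrow> p \<noteq> Some (\<not> \<beta>)" "v = w \<longrightarrow> d \<longrightarrow> \<beta>" "v = w' \<longrightarrow> n \<longrightarrow> \<not> \<beta>" for v \<beta>
  proof -
    \<comment> \<open>The demands of \<open>w\<close> and \<open>w'\<close> are met whatever
      \<open>d\<close> and \<open>n\<close> are. The entry for \<open>v\<close> takes precedence, as
      \<open>v\<close> may be one of the named vertices; the premises \<open>c\<close> ensure that
      it then breaks no demand.\<close>
    define \<pi> where "\<pi> = (\<lambda>x. if x = v then \<beta> else if x = u then p = Some True else x \<in> {w, a})"
    obtain x where x: "x \<in> verts G - set [u, w, w', a, b, v]" "\<forall>y\<in>set [u, w, w', a, b, v]. adj G x y \<longleftrightarrow> \<pi> y"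
      using witness[of "[u, w, w', a, b, v]" \<pi>] u w w' a b v by auto
    have pi: "\<pi> v = \<beta>" "\<pi> a" "d \<longrightarrow> \<pi> w" "n \<longrightarrow> \<not> \<pi> w'" "\<forall>c. p = Some c \<longrightarrow> (\<pi> u \<longleftrightarrow> c)"
      using c u w w' a by (auto simp: \<pi>_def)
    have "x \<in> X0" using x pi by (auto simp: X0_def)
    moreover have "x \<noteq> v" "adj G v x \<longleftrightarrow> \<beta>" using x pi adj_sym[of v] by auto
    ultimately show ?thesis by blast
  qed
  have hit: "\<exists>x\<in>X. x \<noteq> v \<and> (adj G v x \<longleftrightarrow> \<beta>)"
    if "v \<in> verts G" "v = u \<longrightarrow> p \<noteq> Some (\<not> \<beta>)" "v = w \<longrightarrow> d \<longrightarrow> \<beta>" "v = w' \<longrightarrow> n \<longrightarrow> \<not> \<beta>" for v \<beta>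
  proof (cases "v = a \<and> \<not> \<beta>")
    case True
    then show ?thesis using a mem(4) by (intro bexI[of _ b]) auto
  next
    case False
    then have "v = a \<longrightarrow> \<beta>" by auto
    from hit0[OF that(1) this that(2-4)] show ?thesis by (auto simp: X_def)
  qed
  have hitY: "\<exists>x\<in>verts G - X. x \<noteq> v \<and> (adj G v x \<longleftrightarrow> \<beta>)" if v: "v \<in> verts G" for v \<beta>
  proof (cases "v = a \<and> \<beta>")
    case True
    then show ?thesis using a mem(2) w by (intro bexI[of _ w]) auto
  next
    case False
    obtain x where x: "x \<in> verts G - set [u, a, b, v]" "\<forall>y\<in>set [u, a, b, v]. adj G x y \<longleftrightarrow> (y = v \<and> \<beta>)"
      using witness[of "[u, a, b, v]" "\<lambda>y. y = v \<and> \<beta>"] u a b v by auto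
    then have "\<not> adj G x a" using False by auto
    then have "x \<in> verts G - X" using x by (auto simp: X_def X0_def)
    moreover have "x \<noteq> v" "adj G v x \<longleftrightarrow> \<beta>" using x adj_sym[of v] by auto
    ultimately show ?thesis by blast
  qed
  have Y: "nbr_status G (verts G - X) v = (True, True)" if "v \<in> verts G" for v
    using hitY[OF that, of True] hitY[OF that, of False] unfolding nbr_status_def by blast
  have allu: "adj G u x \<longleftrightarrow> c" if "p = Some c" "x \<in> X" "x \<noteq> u" for x c
    using that b adj_sym[of u] by (auto simp: X_def X0_def)
  have allw: "adj G w x" if "d" "x \<in> X" for x
    using that b w adj_sym[of w] by (auto simp: X_def X0_def split: if_splits)
  have allw': "\<not> adj G w' x" if "n" "x \<in> X" for x
    using that b w' adj_sym[of w'] by (auto simp: X_def X0_def split: if_splits)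
  have st: "nbr_status G X v = (True, True)"
    if "v \<in> verts G" "v = u \<longrightarrow> p = None" "v = w \<longrightarrow> \<not> d" "v = w' \<longrightarrow> \<not> n" for v
    using hit[OF that(1), of True] hit[OF that(1), of False] that unfolding nbr_status_def by auto
  have stu: "nbr_status G X u = (c, \<not> c)" if "p = Some c" for c
    using hit[OF u, of c] allu[OF that] that u w w' unfolding nbr_status_def by auto
  have stw: "nbr_status G X w = (True, False)" if d
    using hit[OF w(1), of True] allw[OF that] w w' unfolding nbr_status_def by auto
  have stw': "nbr_status G X w' = (False, True)" if n
    using hit[OF w'(1), of False] allw'[OF that] w w' unfolding nbr_status_def by auto
  have ty: "vtype G X v = (v \<in> X, nbr_status G X v, (True, True))" if "v \<in> verts G" for v
    using Y[OF that] by (simp add: vtype_def)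
  have "vtypes G X = ?R"
  proof (intro equalityI subsetI)
    fix z assume "z \<in> vtypes G X"
    then obtain v where v: "v \<in> verts G" "z = vtype G X v" by (auto simp: vtypes_def)
    consider c where "v = u" "p = Some c" | "v = w" d | "v = w'" n
      | "v = u \<longrightarrow> p = None" "v = w \<longrightarrow> \<not> d" "v = w' \<longrightarrow> \<not> n" by (cases p) auto
    then show "z \<in> ?R"
    proof cases
      case 1
      then show ?thesis using v ty stu mem by auto
    next
      case 2
      then show ?thesis using v ty stw mem by auto
    next
      case 3
      then show ?thesis using v ty stw' mem by auto
    next
      case 4
      then show ?thesis using v ty st[OF v(1) 4] by (cases "v \<in> X") auto
    qed
  next
    fix z assume "z \<in> ?R"
    then consider "z = (True, (True, True), (True, True))" | "z = (False, (True, True), (True, True))"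
      | c where "p = Some c" "z = (True, (c, \<not> c), (True, True))"
      | d "z = (False, (True, False), (True, True))"
      | n "z = (False, (False, True), (True, True))" by (auto split: if_splits option.splits)
    then have "\<exists>v\<in>verts G. vtype G X v = z"
    proof cases
      case 1
      then show ?thesis using ty[of b] st[of b] b mem by (intro bexI[of _ b]) auto
    next
      case 2
      then show ?thesis using ty[of a] st[of a] a mem by (intro bexI[of _ a]) auto
    next
      case 3
      then show ?thesis using ty[of u] stu u mem by (intro bexI[of _ u]) auto
    next
      case 4
      then show ?thesis using ty[of w] stw w mem by (intro bexI[of _ w]) auto
    next
      case 5
      then show ?thesis using ty[of w'] stw' w' mem by (intro bexI[of _ w']) auto
    qed
    then show "z \<in> vtypes G X" by (auto simp: vtypes_def)
  qed
  with XV show ?thesis by blast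
qed

end

section \<open>Maximal cliques and non-mixed vertices\<close>

lemma maxcl_extend:
  assumes G: "is_graph G" and X: "X \<subseteq> verts G" "cl G X"
  obtains Y where "X \<subseteq> Y" "Y \<subseteq> verts G" "maxcl G Y"
proof -
  have "finite {Y. Y \<subseteq> verts G \<and> cl G Y}" using is_graph_finite[OF G] by simp
  from finite_has_maximal2[OF this, of X] X
  obtain Y where Y: "X \<subseteq> Y" "Y \<subseteq> verts G" "cl G Y"
    and mx: "\<And>Z. Z \<subseteq> verts G \<Longrightarrow> cl G Z \<Longrightarrow> Y \<subseteq> Z \<Longrightarrow> Y = Z" by auto
  have "maxcl G Y" unfolding maxcl_def
  proof (intro conjI notI Y)
    assume "\<exists>z\<in>verts G - Y. \<forall>x\<in>Y. adj G z x"
    then obtain z where z: "z \<in> verts G - Y" "\<forall>x\<in>Y. adj G z x" by blast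
    then have "cl G (insert z Y)" using Y(3) is_graph_sym[OF G] unfolding cl_def by (metis insertE)
    with mx[of "insert z Y"] z Y show False by auto
  qed
  with Y that show thesis by blast
qed

context ext_graph
begin

text \<open>Cliques witnessing the failure of a sentence are large enough for
  \<open>vtypes_clique\<close>: if \<open>X\<close> is within \<open>{a}\<close>, a neighbour and a
  non-neighbour of \<open>a\<close> refute both alternatives.\<close>

lemma clique_two_elements:
  assumes X: "X \<subseteq> verts G" and c: "maxcl G X \<or> \<not> phiC G X"
  obtains x1 x2 where "x1 \<in> X" "x2 \<in> X" "x1 \<noteq> x2"
proof (rule ccontr)
  assume "\<not> thesis"
  with that have small: "\<And>x y. x \<in> X \<Longrightarrow> y \<in> X \<Longrightarrow> x = y" by blast
  obtain a where a: "a \<in> verts G" "X \<subseteq> {a}"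
    using small ex_vert X by (cases "X = {}") blast+
  obtain z z' where "z \<in> verts G" "z \<noteq> a" "adj G z a" "z' \<in> verts G" "z' \<noteq> a" "\<not> adj G z' a"
    using witness[of "[a]" "\<lambda>_. True"] witness[of "[a]" "\<lambda>_. False"] a by auto
  with a have "\<not> maxcl G X" "phiC G X" unfolding maxcl_def phiC_def by blast+
  with c show False by blast
qed

text \<open>Towards \<open>X\<close> the adjacency of \<open>u\<close> is a constant
  \<open>c\<close>. A vertex related to \<open>u\<close> in the opposite way is outside
  \<open>X\<close>, and its adjacency to \<open>v\<close> can still be chosen.\<close>

lemma status_other_side:
  assumes u: "u \<in> verts G" "nbr_status G X u \<noteq> (True, True)" and v: "v \<in> verts G" "v \<noteq> u"
  shows "nbr_status G (verts G - X) v = (True, True)"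
proof -
  obtain c where c: "\<And>x. x \<in> X \<Longrightarrow> x \<noteq> u \<Longrightarrow> (adj G u x \<longleftrightarrow> c)"
    using u(2) unfolding nbr_status_def by auto
  have "\<exists>x\<in>verts G - X. x \<noteq> v \<and> (adj G v x \<longleftrightarrow> \<beta>)" for \<beta>
  proof -
    obtain x where x: "x \<in> verts G" "x \<noteq> u" "x \<noteq> v" "adj G x u \<longleftrightarrow> \<not> c" "adj G x v \<longleftrightarrow> \<beta>"
      using witness[of "[u, v]" "\<lambda>y. if y = u then \<not> c else \<beta>"] u v by auto
    then have "x \<notin> X" using c[of x] adj_sym[of u] by auto
    with x adj_sym[of v] show ?thesis by auto
  qed
  from this[of True] this[of False] show ?thesis unfolding nbr_status_def by auto
qed

lemma status_cases:
  assumes "x1 \<in> X" "x2 \<in> X" "x1 \<noteq> x2"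
  obtains "nbr_status G X v = (True, True)" | "nbr_status G X v = (True, False)"
    | "nbr_status G X v = (False, True)"
proof -
  obtain x where "x \<in> X" "x \<noteq> v" using assms by metis
  then have "nbr_status G X v \<noteq> (False, False)" unfolding nbr_status_def by auto
  then show thesis using that by (cases "nbr_status G X v") auto
qed

text \<open>If \<open>y\<close> is not mixed, it has constant adjacency \<open>c\<close> to
  \<open>X\<close>. Let \<open>z\<close> separate \<open>x1\<close> from \<open>x2\<close> and
  relate to \<open>y\<close> opposite to \<open>c\<close>: then \<open>z\<close> cannot be in
  \<open>X\<close>, and outside it is mixed.\<close>

lemma ex_outside_both:
  assumes X: "X \<subseteq> verts G" and x: "x1 \<in> X" "x2 \<in> X" "x1 \<noteq> x2" and y: "y \<in> verts G - X"
  shows "\<exists>v\<in>verts G - X. nbr_status G X v = (True, True)"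
proof (rule ccontr)
  assume neg: "\<not> ?thesis"
  then obtain c where c: "\<And>x. x \<in> X \<Longrightarrow> x \<noteq> y \<Longrightarrow> (adj G y x \<longleftrightarrow> c)"
    using y unfolding nbr_status_def by blast
  have ne: "y \<noteq> x1" "y \<noteq> x2" using x y by auto
  have "set [x1, x2, y] \<subseteq> verts G" using X x y by auto
  then obtain z where z: "z \<in> verts G" "z \<notin> {x1, x2, y}" "adj G z x1" "\<not> adj G z x2" "adj G z y \<longleftrightarrow> \<not> c"
    using witness[of "[x1, x2, y]" "\<lambda>v. v = y \<and> \<not> c \<or> v = x1"] x(3) ne by auto
  show False
  proof (cases "z \<in> X")
    case True
    then show False using c[of z] z adj_sym[of y z] by auto
  next
    case False
    have "nbr_status G X z = (True, True)" using z x unfolding nbr_status_def by auto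
    with neg False z show False by blast
  qed
qed

end

section \<open>Transfer of type sets from one graph to another\<close>

lemma vtypes_transfer_compl_set:
  assumes X: "X \<subseteq> verts G" and ex: "\<exists>X'\<subseteq>verts H. vtypes H X' = vtypes G (verts G - X)"
  shows "\<exists>X'\<subseteq>verts H. vtypes H X' = vtypes G X"
proof -
  obtain X' where X': "X' \<subseteq> verts H" "vtypes H X' = vtypes G (verts G - X)" using ex by blast
  have "vtypes H (verts H - X') = (\<lambda>(b, p, q). (\<not> b, q, p)) ` vtypes G (verts G - X)"
    using vtypes_compl_set[OF X'(1)] X'(2) by simp
  also have "\<dots> = vtypes G (verts G - (verts G - X))"
    using vtypes_compl_set[of "verts G - X" G] by simp
  also have "verts G - (verts G - X) = X" using X by blast
  finally show ?thesis by blast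
qed

lemma vtypes_transfer_clique:
  assumes G: "ext_graph G" and H: "ext_graph H"
    and phi: "phiC1 G \<longleftrightarrow> phiC1 H" "phiC2 G \<longleftrightarrow> phiC2 H" "phiC3 G \<longleftrightarrow> phiC3 H"
    and X: "X \<subseteq> verts G" "cl G X" and x: "x1 \<in> X" "x2 \<in> X" "x1 \<noteq> x2"
  shows "\<exists>X'\<subseteq>verts H. vtypes H X' = vtypes G X"
proof -
  interpret G: ext_graph G by fact
  interpret H: ext_graph H by fact
  have fin: ?thesis if X': "X' \<subseteq> verts H" "cl H X'" and x': "x1' \<in> X'" "x2' \<in> X'" "x1' \<noteq> x2'"
    and "maxcl H X' \<longleftrightarrow> maxcl G X" "phiC H X' \<longleftrightarrow> phiC G X" for X' x1' x2'
    using G.vtypes_clique[OF X x] H.vtypes_clique[OF X' x'] that(6,7) X'(1) by (intro exI[of _ X']) simp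
  have fin': ?thesis if X': "X' \<subseteq> verts H" "cl H X'" "maxcl H X' \<or> \<not> phiC H X'"
    and "maxcl H X' \<longleftrightarrow> maxcl G X" "phiC H X' \<longleftrightarrow> phiC G X" for X'
    using H.clique_two_elements[OF X'(1,3)] fin[OF X'(1,2) _ _ _ that(4,5)] by metis
  consider "\<not> maxcl G X" "phiC G X" | "maxcl G X" "phiC G X" | "\<not> maxcl G X" "\<not> phiC G X"
    | "maxcl G X" "\<not> phiC G X" by blast
  then show ?thesis
  proof cases
    case 1
    \<comment> \<open>Take an edge: a common neighbour and a common non-neighbour settle both
      bits.\<close>
    obtain a where a: "a \<in> verts H" using H.ex_vert by blast
    obtain b where b: "b \<in> verts H" "b \<noteq> a" "adj H b a"
      using H.witness[of "[a]" "\<lambda>_. True"] a by auto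
    have "\<exists>z\<in>verts H. z \<notin> {a, b} \<and> adj H z a \<and> adj H z b" "\<exists>z\<in>verts H. z \<notin> {a, b} \<and> \<not> adj H z a \<and> \<not> adj H z b"
      using H.witness[of "[a, b]" "\<lambda>_. True"] H.witness[of "[a, b]" "\<lambda>_. False"] a b by auto
    then have "cl H {a, b}" "\<not> maxcl H {a, b}" "phiC H {a, b}"
      using b H.adj_sym[of a b] unfolding cl_def maxcl_def phiC_def by auto
    with fin[of "{a, b}" a b] a b 1 show ?thesis by auto
  next
    case 2
    then have "\<not> phiC2 H" using phi X unfolding phiC2_def by blast
    then obtain X' where "X' \<subseteq> verts H" "maxcl H X'" "phiC H X'" unfolding phiC2_def by blast
    then show ?thesis using fin'[of X'] 2 by (auto simp: maxcl_def)
  next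
    case 3
    then have "\<not> phiC3 H" using phi X unfolding phiC3_def by blast
    then obtain X' where "X' \<subseteq> verts H" "cl H X'" "\<not> maxcl H X'" "\<not> phiC H X'" unfolding phiC3_def by blast
    then show ?thesis using fin'[of X'] 3 by auto
  next
    case 4
    then have "\<not> phiC1 H" using phi X unfolding phiC1_def by blast
    then obtain X' where X': "X' \<subseteq> verts H" "cl H X'" "\<not> phiC H X'" unfolding phiC1_def by blast
    from maxcl_extend[OF H.graph X'(1,2)]
    obtain Y where Y: "X' \<subseteq> Y" "Y \<subseteq> verts H" "maxcl H Y" by blast
    then have "\<not> phiC H Y" using X'(3) unfolding phiC_def by blast
    then show ?thesis using fin'[of Y] 4 Y by (auto simp: maxcl_def)
  qed
qed

lemma ext_graph_gcompl: "ext_graph G \<Longrightarrow> ext_graph (gcompl G)"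
  by (simp add: ext_graph_def is_graph_gcompl ext_prop_gcompl)

lemma vtypes_transfer_ind:
  assumes G: "ext_graph G" and H: "ext_graph H"
    and phi: "phiI1 G \<longleftrightarrow> phiI1 H" "phiI2 G \<longleftrightarrow> phiI2 H" "phiI3 G \<longleftrightarrow> phiI3 H"
    and X: "X \<subseteq> verts G" "ind G X" and x: "x1 \<in> X" "x2 \<in> X" "x1 \<noteq> x2"
  shows "\<exists>X'\<subseteq>verts H. vtypes H X' = vtypes G X"
proof -
  note gG = ext_graph.graph[OF G] and gH = ext_graph.graph[OF H]
  have "cl (gcompl G) X" using cl_gcompl[OF gG] X by simp
  from vtypes_transfer_clique[OF ext_graph_gcompl[OF G] ext_graph_gcompl[OF H] _ _ _ _ this x]
  obtain X' where X': "X' \<subseteq> verts H" "vtypes (gcompl H) X' = vtypes (gcompl G) X"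
    using phi X(1) by (auto simp: phiC123_gcompl gG gH)
  then have "vtypes (gcompl (gcompl H)) X' = vtypes (gcompl (gcompl G)) X"
    using vtypes_gcompl[of X' "gcompl H"] vtypes_gcompl[of X "gcompl G"] X(1) by simp
  with X' show ?thesis by (auto simp: gcompl_gcompl gG gH)
qed

text \<open>If \<open>X\<close> contains a mixed vertex, \<open>vtypes_realize\<close> produces the
  type set in every graph. Otherwise all of \<open>X\<close> has one status, so \<open>X\<close> is
  a clique or independent, and only then are the sentences needed.\<close>

lemma vtypes_transfer_one_sided:
  assumes G: "ext_graph G" and H: "ext_graph H"
    and phiC: "phiC1 G \<longleftrightarrow> phiC1 H" "phiC2 G \<longleftrightarrow> phiC2 H" "phiC3 G \<longleftrightarrow> phiC3 H"
    and phiI: "phiI1 G \<longleftrightarrow> phiI1 H" "phiI2 G \<longleftrightarrow> phiI2 H" "phiI3 G \<longleftrightarrow> phiI3 H"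
    and X: "X \<subseteq> verts G" and x: "x1 \<in> X" "x2 \<in> X" "x1 \<noteq> x2" and y: "y \<in> verts G - X"
    and B: "\<And>v. v \<in> verts G \<Longrightarrow> nbr_status G (verts G - X) v = (True, True)"
  shows "\<exists>X'\<subseteq>verts H. vtypes H X' = vtypes G X"
proof -
  interpret G: ext_graph G by fact
  interpret H: ext_graph H by fact
  define st where "st = nbr_status G X"
  have ty: "vtype G X v = (v \<in> X, st v, (True, True))" if "v \<in> verts G" for v
    using B[OF that] by (simp add: vtype_def st_def)
  obtain y0 where y0: "y0 \<in> verts G - X" "st y0 = (True, True)"
    using G.ex_outside_both[OF X x y] unfolding st_def by blast
  \<comment> \<open>The pair \<open>u\<close>, \<open>v\<close> would be both an edge and a
    non-edge. So at most one non-mixed status occurs inside \<open>X\<close>, and a single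
    \<open>p\<close> can record it.\<close>
  have DN: False if "u \<in> X" "v \<in> X" "st u = (True, False)" "st v = (False, True)" for u v
  proof -
    have "u \<noteq> v" using that by auto
    then show False using that G.adj_sym[of u v] unfolding st_def nbr_status_def by auto
  qed
  show ?thesis
  proof (cases "\<exists>v\<in>X. st v = (True, True)")
    case True
    then obtain b where b: "b \<in> X" "st b = (True, True)" by blast
    define p where "p = (if \<exists>v\<in>X. st v = (True, False) then Some True
        else if \<exists>v\<in>X. st v = (False, True) then Some False else None)"
    define d where "d \<longleftrightarrow> (\<exists>v\<in>verts G - X. st v = (True, False))"
    define n where "n \<longleftrightarrow> (\<exists>v\<in>verts G - X. st v = (False, True))"
    define R where "R = {(True, (True, True), (True, True)), (False, (True, True), (True, True))}
     \<union> (case p of None \<Rightarrow> {} | Some c \<Rightarrow> {(True, (c, \<not> c), (True, True))})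
     \<union> (if d then {(False, (True, False), (True, True))} else {})
     \<union> (if n then {(False, (False, True), (True, True))} else {})"
    have "vtypes G X = R"
    proof (intro equalityI subsetI)
      fix z assume "z \<in> vtypes G X"
      then obtain v where v: "v \<in> verts G" "z = (v \<in> X, st v, (True, True))"
        using ty by (auto simp: vtypes_def)
      show "z \<in> R"
      proof (rule G.status_cases[OF x, of v, folded st_def])
        assume "st v = (True, True)"
        then show ?thesis using v by (cases "v \<in> X") (auto simp: R_def)
      next
        assume s: "st v = (True, False)"
        show ?thesis
        proof (cases "v \<in> X")
          case True
          then have "p = Some True" using s by (auto simp: p_def)
          then show ?thesis using True s v by (auto simp: R_def)
        next
          case False
          then have d using s v by (auto simp: d_def)
          then show ?thesis using False s v by (auto simp: R_def)
        qed
      next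
        assume s: "st v = (False, True)"
        show ?thesis
        proof (cases "v \<in> X")
          case True
          then have "p = Some False" using s DN[of _ v] by (auto simp: p_def)
          then show ?thesis using True s v by (auto simp: R_def)
        next
          case False
          then have n using s v by (auto simp: n_def)
          then show ?thesis using False s v by (auto simp: R_def)
        qed
      qed
    next
      fix z assume "z \<in> R"
      then consider "z = (True, (True, True), (True, True))" | "z = (False, (True, True), (True, True))"
        | c where "p = Some c" "z = (True, (c, \<not> c), (True, True))"
        | d "z = (False, (True, False), (True, True))"
        | n "z = (False, (False, True), (True, True))"
        unfolding R_def by (auto split: if_splits option.splits)
      then have "\<exists>v\<in>verts G. (v \<in> X, st v, (True, True)) = z"
      proof cases
        case 1
        then show ?thesis using b X by (intro bexI[of _ b]) auto
      next
        case 2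
        then show ?thesis using y0 by (intro bexI[of _ y0]) auto
      next
        case 3
        then obtain v where "v \<in> X" "st v = (c, \<not> c)" by (auto simp: p_def split: if_splits)
        then show ?thesis using 3 X by (intro bexI[of _ v]) auto
      next
        case 4
        then show ?thesis by (auto simp: d_def)
      next
        case 5
        then show ?thesis by (auto simp: n_def)
      qed
      then show "z \<in> vtypes G X" using ty unfolding vtypes_def by (metis imageI)
    qed
    then show ?thesis using H.vtypes_realize[of p d n] unfolding R_def by simp
  next
    case False
    show ?thesis
    proof (cases "\<exists>u\<in>X. st u = (True, False)")
      case True
      then have all: "st v = (True, False)" if "v \<in> X" for v
        using G.status_cases[OF x, of v, folded st_def] False DN that by blast
      have "cl G X"
        unfolding cl_def
      proof (intro ballI impI)
        fix a b assume "a \<in> X" "b \<in> X" "a \<noteq> b"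
        then show "adj G a b" using all[of a] unfolding st_def nbr_status_def by auto
      qed
      then show ?thesis using vtypes_transfer_clique[OF G H phiC X _ x] by blast
    next
      case nD: False
      then have all: "st v = (False, True)" if "v \<in> X" for v
        using G.status_cases[OF x, of v, folded st_def] False that by blast
      have "ind G X"
        unfolding ind_def
      proof (intro ballI)
        fix a b assume "a \<in> X" "b \<in> X"
        then show "\<not> adj G a b" using all[of a] G.irrefl[of a] unfolding st_def nbr_status_def by auto
      qed
      then show ?thesis using vtypes_transfer_ind[OF G H phiI X _ x] by blast
    qed
  qed
qed

text \<open>By \<open>status_other_side\<close>, used for both sides, all vertices except
  \<open>u\<close> are mixed towards both, which leaves the type set of a neighbourhood. The
  opposite orientation of \<open>u\<close> becomes this one after exchanging the sides.\<close>

lemma vtypes_transfer_two_sided: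
  assumes G: "ext_graph G" and H: "ext_graph H"
    and X: "X \<subseteq> verts G" and x: "x1 \<in> X" "x2 \<in> X" "x1 \<noteq> x2"
    and y: "y1 \<in> verts G - X" "y2 \<in> verts G - X" "y1 \<noteq> y2"
    and u: "u \<in> verts G" "nbr_status G X u = (True, False)" "nbr_status G (verts G - X) u = (False, True)"
  shows "\<exists>X'\<subseteq>verts H. vtypes H X' = vtypes G X"
proof -
  interpret G: ext_graph G by fact
  interpret H: ext_graph H by fact
  have XX: "verts G - (verts G - X) = X" using X by blast
  have ty: "vtype G X v = (v \<in> X, (True, True), (True, True))" if "v \<in> verts G" "v \<noteq> u" for v
    using G.status_other_side[of u X v] G.status_other_side[of u "verts G - X" v] u that
    unfolding vtype_def XX by simp
  have tyu: "vtype G X u = (u \<in> X, (True, False), (False, True))"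
    using u by (simp add: vtype_def)
  obtain a where a: "a \<in> X" "a \<noteq> u" using x by metis
  obtain b where b: "b \<in> verts G - X" "b \<noteq> u" using y by metis
  have "vtypes G X = {(u \<in> X, (True, False), (False, True)), (True, (True, True), (True, True)),
      (False, (True, True), (True, True))}" (is "_ = ?R")
  proof
    show "vtypes G X \<subseteq> ?R"
    proof
      fix z assume "z \<in> vtypes G X"
      then obtain v where v: "v \<in> verts G" "z = vtype G X v" by (auto simp: vtypes_def)
      then show "z \<in> ?R" using tyu ty[of v] by (cases "v = u") auto
    qed
    have "{vtype G X u, vtype G X a, vtype G X b} \<subseteq> vtypes G X"
      using a b u X unfolding vtypes_def by blast
    then show "?R \<subseteq> vtypes G X" using tyu ty[of a] ty[of b] a b X by auto
  qed
  moreover obtain h where "h \<in> verts H" using H.ex_vert by blast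
  ultimately show ?thesis using H.vtypes_nbhd[of h "u \<in> X"] by auto
qed

lemma vtypes_transfer:
  assumes G: "ext_graph G" and H: "ext_graph H"
    and phiC: "phiC1 G \<longleftrightarrow> phiC1 H" "phiC2 G \<longleftrightarrow> phiC2 H" "phiC3 G \<longleftrightarrow> phiC3 H"
    and phiI: "phiI1 G \<longleftrightarrow> phiI1 H" "phiI2 G \<longleftrightarrow> phiI2 H" "phiI3 G \<longleftrightarrow> phiI3 H"
    and X: "X \<subseteq> verts G"
  shows "\<exists>X'\<subseteq>verts H. vtypes H X' = vtypes G X"
proof -
  interpret G: ext_graph G by fact
  interpret H: ext_graph H by fact
  obtain h where h: "h \<in> verts H" using H.ex_vert by blast
  \<comment> \<open>Sides with at most one vertex are split off, because only they give rise to the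
    status \<open>(False, False)\<close>.\<close>
  have small: "\<exists>X'\<subseteq>verts H. vtypes H X' = vtypes G Z" if Z: "Z \<subseteq> verts G"
    and sm: "\<And>a b. a \<in> Z \<Longrightarrow> b \<in> Z \<Longrightarrow> a = b" for Z
  proof (cases "Z = {}")
    case True
    then show ?thesis using G.vtypes_empty H.vtypes_empty by auto
  next
    case False
    then obtain z where "Z = {z}" using sm by blast
    then show ?thesis using G.vtypes_singleton[of z] H.vtypes_singleton[OF h] Z h by auto
  qed
  let ?Y = "verts G - X"
  have YY: "verts G - ?Y = X" using X by blast
  note compl = vtypes_transfer_compl_set[OF X]
  show ?thesis
  proof (cases "(\<forall>a\<in>X. \<forall>b\<in>X. a = b) \<or> (\<forall>a\<in>?Y. \<forall>b\<in>?Y. a = b)")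
    case True
    then show ?thesis
    proof
      assume "\<forall>a\<in>X. \<forall>b\<in>X. a = b"
      then show ?thesis using small[OF X] by blast
    next
      assume "\<forall>a\<in>?Y. \<forall>b\<in>?Y. a = b"
      then have "\<exists>X'\<subseteq>verts H. vtypes H X' = vtypes G ?Y" by (intro small) auto
      then show ?thesis by (rule compl)
    qed
  next
    case False
    then obtain x1 x2 y1 y2 where x: "x1 \<in> X" "x2 \<in> X" "x1 \<noteq> x2" and y: "y1 \<in> ?Y" "y2 \<in> ?Y" "y1 \<noteq> y2"
      by blast
    note one = vtypes_transfer_one_sided[OF G H phiC phiI]
    consider "\<forall>v\<in>verts G. nbr_status G ?Y v = (True, True)" | "\<forall>v\<in>verts G. nbr_status G X v = (True, True)"
      | u u' where "u \<in> verts G" "nbr_status G X u \<noteq> (True, True)" "u' \<in> verts G" "nbr_status G ?Y u' \<noteq> (True, True)"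
      by blast
    then show ?thesis
    proof cases
      case 1
      then show ?thesis using one[OF X x y(1)] by blast
    next
      case 2
      have "x1 \<in> verts G - ?Y" using x X by blast
      from one[OF Diff_subset y this] have "\<exists>X'\<subseteq>verts H. vtypes H X' = vtypes G ?Y"
        using 2 unfolding YY by blast
      then show ?thesis by (rule compl)
    next
      case 3
      \<comment> \<open>Two distinct vertices, one non-mixed towards each side, would contradict
        each other.\<close>
      then have eq: "u' = u" using G.status_other_side[of u X u'] by blast
      \<comment> \<open>Equal non-mixed statuses would make \<open>u\<close> non-mixed towards the
        whole vertex set.\<close>
      have nD: "nbr_status G X u \<noteq> nbr_status G ?Y u"
      proof
        assume e: "nbr_status G X u = nbr_status G ?Y u"
        have "verts G = X \<union> ?Y" using X by blast
        then have "nbr_status G (verts G) u = (fst (nbr_status G X u) \<or> fst (nbr_status G ?Y u),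
            snd (nbr_status G X u) \<or> snd (nbr_status G ?Y u))"
          unfolding nbr_status_def by auto
        with e G.status_verts[of u] 3 show False by (cases "nbr_status G ?Y u") auto
      qed
      have "nbr_status G X u = (True, False) \<and> nbr_status G ?Y u = (False, True) \<or>
            nbr_status G ?Y u = (True, False) \<and> nbr_status G X u = (False, True)"
        using G.status_cases[OF x, of u] G.status_cases[OF y, of u] nD 3 eq by metis
      then show ?thesis
      proof (elim disjE conjE)
        assume "nbr_status G X u = (True, False)" "nbr_status G ?Y u = (False, True)"
        then show ?thesis using vtypes_transfer_two_sided[OF G H X x y] 3 by blast
      next
        assume "nbr_status G ?Y u = (True, False)" "nbr_status G X u = (False, True)"
        then have "\<exists>X'\<subseteq>verts H. vtypes H X' = vtypes G ?Y"
          using vtypes_transfer_two_sided[OF G H Diff_subset y, of x1 x2 u] x 3 unfolding YY by blast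
        then show ?thesis by (rule compl)
      qed
    qed
  qed
qed

lemma E12_transfer:
  assumes G: "ext_graph G" and H: "ext_graph H"
    and phiC: "phiC1 G \<longleftrightarrow> phiC1 H" "phiC2 G \<longleftrightarrow> phiC2 H" "phiC3 G \<longleftrightarrow> phiC3 H"
    and phiI: "phiI1 G \<longleftrightarrow> phiI1 H" "phiI2 G \<longleftrightarrow> phiI2 H" "phiI3 G \<longleftrightarrow> phiI3 H"
    and \<phi>: "E12 \<phi>" "holds_E12 G \<phi>"
  shows "holds_E12 H \<phi>"
proof -
  obtain X where X: "X \<subseteq> verts G" "sat G X (\<lambda>_. 0) \<phi>" using \<phi>(2) by (auto simp: holds_E12_def)
  obtain X' where X': "X' \<subseteq> verts H" "vtypes H X' = vtypes G X"
    using vtypes_transfer[OF G H phiC phiI X(1)] by blast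
  have "sat G X (\<lambda>_. 0) \<phi> \<longleftrightarrow> sat H X' (\<lambda>_. 0) \<phi>"
    by (rule sat_cong_depth2) (use G H X X' \<phi>(1) in \<open>auto simp: E12_def ext_graph_def\<close>)
  with X X' show ?thesis by (auto simp: holds_E12_def)
qed

section \<open>Generic coloured graphs\<close>

text \<open>With \<open>x\<close> the \<open>k\<close>-th root of \<open>r\<close>, the sequence is
  the \<open>k\<close>-th power of \<open>n * x ^ n\<close>, which reduces everything to exponent
  one.\<close>

lemma poly_times_geometric_tendsto_0:
  fixes r :: real
  assumes "0 \<le> r" "r < 1" "0 < k"
  shows "(\<lambda>n. real n ^ k * r ^ n) \<longlonglongrightarrow> 0"
proof -
  define x where "x = root k r"
  have x: "0 \<le> x" "x ^ k = r" using assms by (auto simp: x_def)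
  have "x < 1" using assms real_root_lt_1_iff by (simp add: x_def)
  then have "(\<lambda>n. (real n * x ^ n) ^ k) \<longlonglongrightarrow> 0 ^ k"
    using x by (intro tendsto_power powser_times_n_limit_0) auto
  moreover have "(real n * x ^ n) ^ k = real n ^ k * r ^ n" for n
    by (simp add: power_mult_distrib x(2)[symmetric] flip: power_mult) (simp add: mult.commute)
  ultimately show ?thesis using assms(3) by (simp add: zero_power)
qed

text \<open>Independence in counting form: for a random subset of \<open>E\<close> the traces on
  disjoint blocks are independent, and each misses its pattern with probability
  \<open>1 - 1 / 2 ^ q\<close>.\<close>

lemma card_avoid_patterns:
  fixes B P :: "'b \<Rightarrow> 'a set"
  assumes "finite A" and E: "finite E"
    and "\<And>v. v \<in> A \<Longrightarrow> B v \<subseteq> E \<and> card (B v) = q \<and> P v \<subseteq> B v"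
    and "\<And>u v. u \<in> A \<Longrightarrow> v \<in> A \<Longrightarrow> u \<noteq> v \<Longrightarrow> B u \<inter> B v = {}"
  shows "real (card {X. X \<subseteq> E \<and> (\<forall>v\<in>A. X \<inter> B v \<noteq> P v)}) = 2 ^ card E * (1 - 1 / 2 ^ q) ^ card A"
  using assms(1,3,4)
proof (induction A rule: finite_induct)
  case empty
  have "{X. X \<subseteq> E \<and> (\<forall>v\<in>{}. X \<inter> B v \<noteq> P v)} = Pow E" by auto
  then show ?case using E by (simp add: card_Pow)
next
  case (insert a A)
  define bad where "bad = {X. X \<subseteq> E \<and> (\<forall>v\<in>A. X \<inter> B v \<noteq> P v)}"
  define hit where "hit = {X \<in> bad. X \<inter> B a = P a}"
  have finbad: "finite bad" using E by (simp add: bad_def)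
  have a: "B a \<subseteq> E" "card (B a) = q" "P a \<subseteq> B a" using insert.prems(1)[of a] by auto
  have disj: "B v \<inter> B a = {}" if "v \<in> A" for v using insert.prems(2)[of v a] insert.hyps(2) that by auto
  have finBa: "finite (B a)" using a E finite_subset by blast
  have inv: "(X - B a) \<union> Q \<in> bad" if "X \<in> bad" "Q \<subseteq> B a" for X Q
  proof -
    have "((X - B a) \<union> Q) \<inter> B v = X \<inter> B v" if "v \<in> A" for v
      using disj[OF that] \<open>Q \<subseteq> B a\<close> by blast
    then show ?thesis using that a(1) by (auto simp: bad_def)
  qed
  \<comment> \<open>A set in \<open>bad\<close> amounts to its trace on \<open>B a\<close> together
    with the set obtained by resetting that trace to \<open>P a\<close>.\<close>
  have "bij_betw (\<lambda>(Q, X). (X - B a) \<union> Q) (Pow (B a) \<times> hit) bad"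
  proof (rule bij_betw_byWitness[where f' = "\<lambda>X. (X \<inter> B a, (X - B a) \<union> P a)"])
    show "\<forall>y\<in>Pow (B a) \<times> hit. (\<lambda>X. (X \<inter> B a, (X - B a) \<union> P a)) ((\<lambda>(Q, X). (X - B a) \<union> Q) y) = y"
      by (auto simp: hit_def)
    show "\<forall>X\<in>bad. (\<lambda>(Q, X). (X - B a) \<union> Q) (X \<inter> B a, (X - B a) \<union> P a) = X"
      using a(3) by auto
    show "(\<lambda>(Q, X). (X - B a) \<union> Q) ` (Pow (B a) \<times> hit) \<subseteq> bad"
      using inv by (auto simp: hit_def)
    show "(\<lambda>X. (X \<inter> B a, (X - B a) \<union> P a)) ` bad \<subseteq> Pow (B a) \<times> hit"
      using inv[OF _ a(3)] a(3) by (auto simp: hit_def)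
  qed
  then have "card bad = 2 ^ q * card hit"
    using bij_betw_same_card finBa a(2) by (fastforce simp: card_cartesian_product card_Pow)
  then have hit: "real (card hit) = real (card bad) / 2 ^ q" by simp
  have "{X. X \<subseteq> E \<and> (\<forall>v\<in>insert a A. X \<inter> B v \<noteq> P v)} = bad - hit"
    by (auto simp: bad_def hit_def)
  moreover have "card (bad - hit) = card bad - card hit"
    using finbad by (intro card_Diff_subset) (auto simp: hit_def)
  moreover have "card hit \<le> card bad" using finbad by (intro card_mono) (auto simp: hit_def)
  ultimately have "real (card {X. X \<subseteq> E \<and> (\<forall>v\<in>insert a A. X \<inter> B v \<noteq> P v)}) = real (card bad) * (1 - 1 / 2 ^ q)"
    by (simp add: hit algebra_simps of_nat_diff)
  also have "real (card bad) = 2 ^ card E * (1 - 1 / 2 ^ q) ^ card A"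
    unfolding bad_def by (rule insert.IH) (use insert.prems in auto)
  finally show ?case using insert.hyps by simp
qed

lemma mod_class_eq:
  fixes m b N i :: nat
  assumes "i < m"
  shows "{v\<in>{b * m..<(b + N) * m}. v mod m = i} = (\<lambda>k. k * m + i) ` {b..<b + N}"
proof (intro equalityI subsetI)
  fix v assume v: "v \<in> {v\<in>{b * m..<(b + N) * m}. v mod m = i}"
  then have "v = (v div m) * m + i" by (metis (mono_tags, lifting) div_mult_mod_eq mem_Collect_eq)
  moreover have "v div m \<in> {b..<b + N}"
    using v assms by (auto simp: less_eq_div_iff_mult_less_eq less_mult_imp_div_less)
  ultimately show "v \<in> (\<lambda>k. k * m + i) ` {b..<b + N}" by blast
next
  fix v assume "v \<in> (\<lambda>k. k * m + i) ` {b..<b + N}"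
  then obtain k where k: "b \<le> k" "k < b + N" "v = k * m + i" by auto
  have "k * m + i < (k + 1) * m" using assms by simp
  also have "\<dots> \<le> (b + N) * m" using k by (intro mult_le_mono1) auto
  finally have "v < (b + N) * m" using k by simp
  moreover have "b * m \<le> v" using k by (simp add: trans_le_add1)
  ultimately show "v \<in> {v\<in>{b * m..<(b + N) * m}. v mod m = i}" using k assms by auto
qed

text \<open>A union bound by counting: an edge set is bad for \<open>(i, S, T)\<close> if no vertex
  of colour \<open>i\<close> outside \<open>S\<close> has trace \<open>T\<close>. There are
  polynomially many triples in \<open>N\<close>, and each excludes at most a fraction
  \<open>\<rho> ^ (N - q)\<close> of all edge sets.\<close>

lemma generic_coloured_graph_exact:
  fixes m q b :: nat
  assumes m: "0 < m" and q: "0 < q"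
  shows "\<exists>U r. finite U \<and> q \<le> card U \<and> (\<forall>v\<in>U. b \<le> v) \<and> (\<forall>u v. r u v \<longrightarrow> r v u) \<and> (\<forall>u. \<not> r u u) \<and>
    (\<forall>i<m. \<forall>S T. S \<subseteq> U \<longrightarrow> card S = q \<longrightarrow> T \<subseteq> S \<longrightarrow>
       (\<exists>v\<in>U - S. v mod m = i \<and> (\<forall>u\<in>S. r v u \<longleftrightarrow> u \<in> T)))"
proof -
  define \<rho> :: real where "\<rho> = 1 - 1 / 2 ^ q"
  have "2 ^ q > (1::real)" using q by simp
  then have \<rho>: "0 < \<rho>" "\<rho> < 1" by (auto simp: \<rho>_def)
  \<comment> \<open>The factors of the union bound independent of \<open>N\<close>. Division by
    \<open>\<rho> ^ q\<close> pays for the vertices of a colour class lost to \<open>S\<close>, at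
    most \<open>q\<close> of them.\<close>
  define c where "c = real m * real m ^ q * 2 ^ q / \<rho> ^ q"
  have cpos: "0 < c" using m \<rho> by (simp add: c_def)
  have "(\<lambda>n. c * (real n ^ q * \<rho> ^ n)) \<longlonglongrightarrow> c * 0"
    using poly_times_geometric_tendsto_0[of \<rho> q] \<rho> q by (intro tendsto_mult) auto
  then have "eventually (\<lambda>n. c * (real n ^ q * \<rho> ^ n) < 1) sequentially"
    using order_tendstoD(2) by fastforce
  then have "eventually (\<lambda>n. c * (real n ^ q * \<rho> ^ n) < 1 \<and> q \<le> n) sequentially"
    using eventually_ge_at_top eventually_conj by blast
  then obtain N where N: "c * (real N ^ q * \<rho> ^ N) < 1" "q \<le> N"
    using eventually_happens by force
  \<comment> \<open>An interval between multiples of \<open>m\<close> has exactly \<open>N\<close>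
    elements in each residue class, and \<open>b \<le> b * m\<close> keeps it above
    \<open>b\<close>.\<close>
  define U where "U = {b * m..<(b + N) * m}"
  define C where "C i = {v\<in>U. v mod m = i}" for i
  define E where "E = {e. e \<subseteq> U \<and> card e = 2}"
  have finU: "finite U" and cardU: "card U = N * m" by (auto simp: U_def algebra_simps)
  have q_le: "q \<le> card U"
  proof -
    have "N * 1 \<le> N * m" using m by (intro mult_le_mono2) simp
    with N(2) cardU show ?thesis by linarith
  qed
  have finE: "finite E" using finU by (simp add: E_def)
  have cardC: "card (C i) = N" if "i < m" for i
  proof -
    have "inj_on (\<lambda>k. k * m + i) {b..<b + N}" using m by (auto simp: inj_on_def)
    then show ?thesis unfolding C_def U_def mod_class_eq[OF that] by (simp add: card_image)
  qed
  define \<Theta> where "\<Theta> = {..<m} \<times> (SIGMA S : {S. S \<subseteq> U \<and> card S = q}. Pow S)"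
  \<comment> \<open>The possible edges from \<open>v\<close> to \<open>S\<close>. For distinct
    \<open>v\<close> outside \<open>S\<close> they are disjoint, as independence requires.\<close>
  define star where "star v S = (\<lambda>u. {v, u :: nat}) ` S" for v S
  define bad where "bad = (\<lambda>(i, S, T). {X. X \<subseteq> E \<and> (\<forall>v\<in>C i - S. X \<inter> star v S \<noteq> star v T)})"
  have fin\<Theta>: "finite \<Theta>" using finU unfolding \<Theta>_def
    by (intro finite_SigmaI finite_cartesian_product) (auto intro: finite_subset)
  have inj_star: "inj_on (\<lambda>u. {v, u}) S" for v :: nat and S
    by (auto simp: inj_on_def doubleton_eq_iff)
  have bad_card: "real (card (bad \<theta>)) \<le> 2 ^ card E * \<rho> ^ (N - q)" if "\<theta> \<in> \<Theta>" for \<theta>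
  proof -
    obtain i S T where \<theta>: "\<theta> = (i, S, T)" "i < m" "S \<subseteq> U" "card S = q" "T \<subseteq> S"
      using \<open>\<theta> \<in> \<Theta>\<close> by (auto simp: \<Theta>_def)
    have "finite S" using \<theta> finU finite_subset by blast
    have "real (card {X. X \<subseteq> E \<and> (\<forall>v\<in>C i - S. X \<inter> star v S \<noteq> star v T)}) =
        2 ^ card E * (1 - 1 / 2 ^ q) ^ card (C i - S)"
    proof (rule card_avoid_patterns[OF _ finE])
      show "finite (C i - S)" using finU by (simp add: C_def)
      show "star v S \<subseteq> E \<and> card (star v S) = q \<and> star v T \<subseteq> star v S" if "v \<in> C i - S" for v
        using that \<theta> card_image[OF inj_star, of v S] by (auto simp: star_def E_def C_def card_insert_if)
      show "star u S \<inter> star v S = {}" if "u \<in> C i - S" "v \<in> C i - S" "u \<noteq> v" for u v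
        using that by (auto simp: star_def doubleton_eq_iff)
    qed
    also have "(1 - 1 / 2 ^ q) ^ card (C i - S) \<le> \<rho> ^ (N - q)"
      unfolding \<rho>_def[symmetric]
    proof (rule power_decreasing)
      show "N - q \<le> card (C i - S)"
        using diff_card_le_card_Diff[OF \<open>finite S\<close>, of "C i"] cardC[OF \<theta>(2)] \<theta>(4) by simp
    qed (use \<rho> in auto)
    finally show ?thesis by (simp add: \<theta>(1) bad_def)
  qed
  have "card \<Theta> = m * ((N * m choose q) * 2 ^ q)"
  proof -
    have "card (SIGMA S : {S. S \<subseteq> U \<and> card S = q}. Pow S) = (\<Sum>S\<in>{S. S \<subseteq> U \<and> card S = q}. card (Pow S))"
      using finU by (intro card_SigmaI) (auto intro: finite_subset)
    also have "\<dots> = (\<Sum>S\<in>{S. S \<subseteq> U \<and> card S = q}. 2 ^ q)"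
    proof (rule sum.cong[OF refl])
      fix S assume "S \<in> {S. S \<subseteq> U \<and> card S = q}"
      then have "finite S" "card S = q" using finU finite_subset by auto
      then show "card (Pow S) = 2 ^ q" by (simp add: card_Pow)
    qed
    also have "\<dots> = (N * m choose q) * 2 ^ q" by (simp add: n_subsets[OF finU] cardU)
    finally show ?thesis by (simp add: \<Theta>_def card_cartesian_product)
  qed
  moreover have "N * m choose q \<le> (N * m) ^ q"
    using q_le cardU by (intro binomial_le_pow) simp
  ultimately have "card \<Theta> \<le> m * ((N * m) ^ q * 2 ^ q)" by simp
  then have card\<Theta>: "real (card \<Theta>) \<le> real m * ((real N * real m) ^ q * 2 ^ q)"
    by (metis (mono_tags, opaque_lifting) of_nat_le_iff of_nat_mult of_nat_numeral of_nat_power)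
  have "real (card (\<Union>\<theta>\<in>\<Theta>. bad \<theta>)) \<le> (\<Sum>\<theta>\<in>\<Theta>. real (card (bad \<theta>)))"
    using card_UN_le[OF fin\<Theta>, of bad] by (metis of_nat_le_iff of_nat_sum)
  also have "\<dots> \<le> real (card \<Theta>) * (2 ^ card E * \<rho> ^ (N - q))"
    using bad_card by (intro sum_bounded_above) auto
  also have "\<dots> \<le> real m * ((real N * real m) ^ q * 2 ^ q) * (2 ^ card E * \<rho> ^ (N - q))"
    using card\<Theta> \<rho> by (intro mult_right_mono) auto
  also have "\<dots> = 2 ^ card E * (c * (real N ^ q * \<rho> ^ N))"
    using \<rho> N(2) by (simp add: c_def power_diff power_mult_distrib field_simps)
  also have "\<dots> < 2 ^ card E * 1"
    using N(1) by (intro mult_strict_left_mono) auto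
  also have "\<dots> = real (card (Pow E))" using finE by (simp add: card_Pow)
  finally have "card (\<Union>\<theta>\<in>\<Theta>. bad \<theta>) < card (Pow E)" by simp
  then have "(\<Union>\<theta>\<in>\<Theta>. bad \<theta>) \<noteq> Pow E" by auto
  moreover have "(\<Union>\<theta>\<in>\<Theta>. bad \<theta>) \<subseteq> Pow E" by (auto simp: bad_def)
  ultimately have "\<exists>X\<in>Pow E. X \<notin> (\<Union>\<theta>\<in>\<Theta>. bad \<theta>)" by (meson subset_antisym subsetI)
  then obtain X where X: "X \<subseteq> E" "\<And>\<theta>. \<theta> \<in> \<Theta> \<Longrightarrow> X \<notin> bad \<theta>" by blast
  define r where "r u v \<longleftrightarrow> u \<noteq> v \<and> {u, v} \<in> X" for u v
  have "\<exists>v\<in>U - S. v mod m = i \<and> (\<forall>u\<in>S. r v u \<longleftrightarrow> u \<in> T)"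
    if "i < m" "S \<subseteq> U" "card S = q" "T \<subseteq> S" for i S T
  proof -
    have "X \<notin> bad (i, S, T)" using that by (intro X(2)) (auto simp: \<Theta>_def)
    then obtain v where v: "v \<in> C i - S" "X \<inter> star v S = star v T"
      using X(1) by (auto simp: bad_def)
    have "r v u \<longleftrightarrow> u \<in> T" if "u \<in> S" for u
    proof -
      have "r v u \<longleftrightarrow> {v, u} \<in> X \<inter> star v S" using v that by (auto simp: r_def star_def)
      also have "\<dots> \<longleftrightarrow> u \<in> T" unfolding v(2) by (auto simp: star_def doubleton_eq_iff)
      finally show ?thesis .
    qed
    then show ?thesis using v by (auto simp: C_def)
  qed
  moreover have "b \<le> v" if "v \<in> U" for v
  proof -
    have "b * 1 \<le> b * m" using m by (intro mult_le_mono2) simp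
    also have "\<dots> \<le> v" using that by (simp add: U_def)
    finally show ?thesis by simp
  qed
  ultimately show ?thesis using finU q_le 
    by (intro exI[of _ U] exI[of _ r]) (simp add: r_def insert_commute)
qed

text \<open>Sets of at most \<open>q\<close> vertices are padded to exactly \<open>Suc q\<close>;
  the successor keeps the size positive when \<open>q = 0\<close>.\<close>

lemma generic_coloured_graph:
  fixes m q b :: nat
  assumes m: "0 < m"
  obtains U r where "finite U" "\<And>v. v \<in> U \<Longrightarrow> b \<le> v"
    "\<And>u v. r u v \<Longrightarrow> r v u" "\<And>u. \<not> r u u"
    "\<And>i S T. i < m \<Longrightarrow> S \<subseteq> U \<Longrightarrow> card S \<le> q \<Longrightarrow> T \<subseteq> S \<Longrightarrow>
       \<exists>v\<in>U - S. v mod m = i \<and> (\<forall>u\<in>S. r v u \<longleftrightarrow> u \<in> T)"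
proof -
  obtain U r where U: "finite U" "Suc q \<le> card U" "\<forall>v\<in>U. b \<le> v" and r: "\<forall>u v. r u v \<longrightarrow> r v u" "\<forall>u. \<not> r u u"
    and wit: "\<forall>i<m. \<forall>S T. S \<subseteq> U \<longrightarrow> card S = Suc q \<longrightarrow> T \<subseteq> S \<longrightarrow>
       (\<exists>v\<in>U - S. v mod m = i \<and> (\<forall>u\<in>S. r v u \<longleftrightarrow> u \<in> T))"
    using generic_coloured_graph_exact[OF m zero_less_Suc[of q], of b] by (elim exE conjE) (rule that)
  have "\<exists>v\<in>U - S. v mod m = i \<and> (\<forall>u\<in>S. r v u \<longleftrightarrow> u \<in> T)"
    if iST: "i < m" "S \<subseteq> U" "card S \<le> q" "T \<subseteq> S" for i S T
  proof -
    have "card S \<le> Suc q" using iST(3) by simp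
    then obtain S' where S': "S \<subseteq> S'" "S' \<subseteq> U" "card S' = Suc q"
      using exists_subset_between[OF _ U(2) iST(2) U(1)] by blast
    then have "\<exists>v\<in>U - S'. v mod m = i \<and> (\<forall>u\<in>S'. r v u \<longleftrightarrow> u \<in> T)"
      using wit iST by blast
    then show ?thesis using S'(1) by blast
  qed
  then show thesis using U(3) r by (intro that[of U r, OF U(1)]) auto
qed

section \<open>Generic multipartite graphs over a frame\<close>

text \<open>The frame \<open>W\<close> may carry any graph: the extension property is witnessed by the \<open>t\<close>-partite set \<open>V0\<close> alone.
  A vertex of part \<open>i\<close> has a member of \<open>F i\<close> as its neighbourhood in \<open>W\<close>, and all combinations allowed by this
  occur. Thus only the family \<open>F\<close> and the graph on \<open>W\<close> have to be designed to control the cliques, whose trace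
  on \<open>V0\<close> has at most \<open>t\<close> vertices.\<close>

locale framed_graph =
  fixes G :: graph and t :: nat and V0 W :: "nat set" and part :: "nat \<Rightarrow> nat" and F :: "nat \<Rightarrow> nat set set"
  assumes graph: "is_graph G"
    and verts: "verts G = V0 \<union> W" "V0 \<inter> W = {}"
    and part_less: "\<And>v. v \<in> V0 \<Longrightarrow> part v < t"
    and part_indep: "\<And>u v. u \<in> V0 \<Longrightarrow> v \<in> V0 \<Longrightarrow> adj G u v \<Longrightarrow> part u \<noteq> part v"
    and nbhd: "\<And>v. v \<in> V0 \<Longrightarrow> {w\<in>W. adj G v w} \<in> F (part v)"
    and generic: "\<And>i f S T. i < t \<Longrightarrow> f \<in> F i \<Longrightarrow> S \<subseteq> V0 \<Longrightarrow> card S \<le> t \<Longrightarrow> T \<subseteq> S \<Longrightarrow> i \<notin> part ` T \<Longrightarrow>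
      \<exists>v\<in>V0 - S. part v = i \<and> {w\<in>W. adj G v w} = f \<and> (\<forall>u\<in>S. adj G v u \<longleftrightarrow> u \<in> T)"
begin

lemmas adj_sym = is_graph_sym[OF graph]

lemma finite_V0: "finite V0" and finite_W: "finite W"
  using is_graph_finite[OF graph] verts by auto

lemma clique_V0:
  assumes "Z \<subseteq> V0" "cl G Z"
  shows "inj_on part Z" "card Z \<le> t"
proof -
  show inj: "inj_on part Z"
    using assms part_indep unfolding inj_on_def cl_def by (metis subsetD)
  have "part ` Z \<subseteq> {..<t}" using assms part_less by auto
  then have "card (part ` Z) \<le> t" using card_mono[of "{..<t}"] by fastforce
  then show "card Z \<le> t" using card_image[OF inj] by simp
qed

lemma clique_inter_V0:
  assumes "cl G X"
  shows "inj_on part (X \<inter> V0)" "card (X \<inter> V0) \<le> t"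
  using clique_V0[of "X \<inter> V0"] assms unfolding cl_def by auto

text \<open>Genericity handles the small trace of \<open>X\<close> on \<open>V0\<close>, so only the
  frame matters: one permitted neighbourhood missing \<open>X\<close> is enough.\<close>

lemma phiC_if_avoiding:
  assumes X: "X \<subseteq> verts G" "cl G X" and f: "i < t" "f \<in> F i" "f \<inter> X = {}"
  shows "phiC G X"
proof -
  obtain v where v: "v \<in> V0 - (X \<inter> V0)" "{w\<in>W. adj G v w} = f" "\<forall>u\<in>X \<inter> V0. \<not> adj G v u"
    using generic[OF f(1,2) _ clique_inter_V0(2)[OF X(2)], of "{}"] by auto
  then have "\<forall>x\<in>X. \<not> adj G v x" using X(1) f(3) verts by blast
  with v show ?thesis unfolding phiC_def verts by blast
qed

text \<open>The dual criterion. The part \<open>i\<close> must be missed by \<open>X\<close>,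
  because a new vertex cannot be joined to its own part.\<close>

lemma not_maxcl_if_containing:
  assumes X: "X \<subseteq> verts G" "cl G X" and f: "i < t" "i \<notin> part ` (X \<inter> V0)" "f \<in> F i" "X \<inter> W \<subseteq> f"
  shows "\<not> maxcl G X"
proof -
  obtain v where v: "v \<in> V0 - (X \<inter> V0)" "{w\<in>W. adj G v w} = f" "\<forall>u\<in>X \<inter> V0. adj G v u"
    using generic[OF f(1,3) _ clique_inter_V0(2)[OF X(2)], of "X \<inter> V0"] f(2) by auto
  then have "\<forall>x\<in>X. adj G v x" using X(1) f(4) verts by blast
  with v show ?thesis unfolding maxcl_def verts by blast
qed

text \<open>Turns the extension property into a condition on \<open>F\<close> alone:
  \<open>P\<close> collects the parts met by the given vertices in \<open>V0\<close>, and
  \<open>T\<close> is the trace prescribed on those in \<open>W\<close>.\<close>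

lemma ext_prop_if_rich:
  assumes s: "s \<le> t"
    and rich: "\<And>P S T. S \<subseteq> W \<Longrightarrow> card P + card S \<le> s \<Longrightarrow> finite P \<Longrightarrow> T \<subseteq> S \<Longrightarrow>
      \<exists>i<t. i \<notin> P \<and> (\<exists>f\<in>F i. f \<inter> S = T)"
  shows "ext_prop s G"
  unfolding ext_prop_def
proof (intro conjI allI impI)
  obtain i f where f: "i < t" "f \<in> F i" using rich[of "{}" "{}" "{}"] by auto
  \<comment> \<open>Otherwise \<open>S = V0\<close> would be small enough for
    \<open>generic\<close>, giving a vertex of \<open>V0\<close> outside \<open>V0\<close>.\<close>
  have "t \<le> card V0"
  proof (rule ccontr)
    assume "\<not> t \<le> card V0"
    then show False using generic[OF f order_refl, of "{}"] by auto
  qed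
  moreover have "card V0 \<le> card (verts G)"
    using verts is_graph_finite[OF graph] by (intro card_mono) auto
  ultimately show "s \<le> card (verts G)" using s by linarith
next
  fix S T assume S: "S \<subseteq> verts G" "card S = s" "T \<subseteq> S"
  have finS: "finite S" using S(1) is_graph_finite[OF graph] finite_subset by blast
  have "S = (S \<inter> V0) \<union> (S \<inter> W)" using S(1) verts by auto
  then have "card S = card (S \<inter> V0) + card (S \<inter> W)"
    using finS verts(2) card_Un_disjoint[of "S \<inter> V0" "S \<inter> W"] by fastforce
  then have c: "card (S \<inter> V0) + card (S \<inter> W) = s" using S(2) by simp
  have cp: "card (part ` (S \<inter> V0)) \<le> card (S \<inter> V0)" using finS by (intro card_image_le) auto
  obtain i f where f: "i < t" "i \<notin> part ` (S \<inter> V0)" "f \<in> F i" "f \<inter> (S \<inter> W) = T \<inter> W"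
    using rich[of "S \<inter> W" "part ` (S \<inter> V0)" "T \<inter> W"] c cp S(3) finS by auto
  have "card (S \<inter> V0) \<le> t" using c s by linarith
  then obtain v where v: "v \<in> V0 - (S \<inter> V0)" "{w\<in>W. adj G v w} = f" "\<forall>u\<in>S \<inter> V0. adj G v u \<longleftrightarrow> u \<in> T \<inter> V0"
    using generic[OF f(1,3), of "S \<inter> V0" "T \<inter> V0"] f(2) S(3) by auto
  have "adj G v u \<longleftrightarrow> u \<in> T" if "u \<in> S" for u
  proof (cases "u \<in> V0")
    case True
    then show ?thesis using v(3) that by auto
  next
    case False
    then have "u \<in> W" using that S(1) verts by auto
    then show ?thesis using v(2) f(4) that by auto
  qed
  then show "\<exists>z\<in>verts G. z \<notin> S \<and> (\<forall>t\<in>T. adj G z t) \<and> (\<forall>u\<in>S - T. \<not> adj G z u)"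
    using v(1) verts S(3) by (intro bexI[of _ v]) auto
qed

end

text \<open>A colour encodes a part together with a neighbourhood in \<open>W\<close>. Edges inside
  a part are dropped, which does no harm: \<open>generic\<close> never asks for an edge from part
  \<open>i\<close> to itself.\<close>

lemma framed_graph_exists:
  fixes W :: "nat set" and aW :: "nat \<Rightarrow> nat \<Rightarrow> bool" and F :: "nat \<Rightarrow> nat set set"
  assumes W: "finite W" and F: "\<And>i. i < t \<Longrightarrow> F i \<subseteq> Pow W"
    and aW: "\<And>u v. aW u v \<Longrightarrow> aW v u" "\<And>u. \<not> aW u u"
    and ne: "i0 < t" "f0 \<in> F i0"
  obtains G V0 part where "framed_graph G t V0 W part F"
    "\<And>u v. u \<in> W \<Longrightarrow> v \<in> W \<Longrightarrow> adj G u v \<longleftrightarrow> aW u v"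
proof -
  define \<Lambda> where "\<Lambda> = (SIGMA i : {..<t}. F i)"
  have fin: "finite \<Lambda>" unfolding \<Lambda>_def
    using F W by (intro finite_SigmaI) (auto intro: finite_subset)
  obtain e where e: "bij_betw e {0..<card \<Lambda>} \<Lambda>" using ex_bij_betw_nat_finite[OF fin] by blast
  define m where "m = card \<Lambda>"
  have "(i0, f0) \<in> \<Lambda>" using ne by (simp add: \<Lambda>_def)
  then have m: "0 < m" using fin by (auto simp: m_def card_gt_0_iff)
  obtain b where b: "\<forall>w\<in>W. w < b" using W finite_nat_set_iff_bounded by blast
  obtain U r where U: "finite U" "\<And>v. v \<in> U \<Longrightarrow> b \<le> v"
    and r: "\<And>u v. r u v \<Longrightarrow> r v u" "\<And>u. \<not> r u u"
    and wit: "\<And>i S T. i < m \<Longrightarrow> S \<subseteq> U \<Longrightarrow> card S \<le> t \<Longrightarrow> T \<subseteq> S \<Longrightarrow>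
       \<exists>v\<in>U - S. v mod m = i \<and> (\<forall>u\<in>S. r v u \<longleftrightarrow> u \<in> T)"
    using generic_coloured_graph[OF m, of b t] by metis
  define part where "part v = fst (e (v mod m))" for v
  define col where "col v = snd (e (v mod m))" for v
  have in\<Lambda>: "(part v, col v) \<in> \<Lambda>" for v
    using e m by (auto simp: part_def col_def m_def bij_betw_def)
  have part: "part v < t" and col: "col v \<in> F (part v)" for v
    using in\<Lambda>[of v] by (auto simp: \<Lambda>_def)
  have colW: "col v \<subseteq> W" for v using F[OF part] col by blast
  define G where "G = \<lparr>verts = U \<union> W, adj = \<lambda>u v.
      u \<in> U \<and> v \<in> U \<and> r u v \<and> part u \<noteq> part v \<or> u \<in> U \<and> v \<in> col u \<or> v \<in> U \<and> u \<in> col v \<or>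
      u \<in> W \<and> v \<in> W \<and> aW u v\<rparr>"
  have disj: "U \<inter> W = {}" using U(2) b by fastforce
  have adjUU: "adj G u v \<longleftrightarrow> r u v \<and> part u \<noteq> part v" if "u \<in> U" "v \<in> U" for u v
    using that disj colW by (auto simp: G_def)
  have adjUW: "adj G u w \<longleftrightarrow> w \<in> col u" if "u \<in> U" "w \<in> W" for u w
    using that disj colW by (auto simp: G_def)
  have adjWW: "adj G u v \<longleftrightarrow> aW u v" if "u \<in> W" "v \<in> W" for u v
    using that disj by (auto simp: G_def)
  have nb: "{w\<in>W. adj G v w} = col v" if "v \<in> U" for v
    using that adjUW colW by blast
  have "framed_graph G t U W part F"
  proof
    show "is_graph G"
      using U(1) W colW disj aW r unfolding is_graph_def G_def by auto
    show "verts G = U \<union> W" "U \<inter> W = {}" using disj by (auto simp: G_def)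
    show "part v < t" for v by (rule part)
    show "part u \<noteq> part v" if "u \<in> U" "v \<in> U" "adj G u v" for u v using that adjUU by simp
    show "{w\<in>W. adj G v w} \<in> F (part v)" if "v \<in> U" for v using nb[OF that] col by simp
    show "\<exists>v\<in>U - S. part v = i \<and> {w\<in>W. adj G v w} = f \<and> (\<forall>u\<in>S. adj G v u \<longleftrightarrow> u \<in> T)"
      if ifST: "i < t" "f \<in> F i" "S \<subseteq> U" "card S \<le> t" "T \<subseteq> S" "i \<notin> part ` T" for i f S T
    proof -
      have "(i, f) \<in> \<Lambda>" using ifST by (simp add: \<Lambda>_def)
      then obtain k where k: "k < m" "e k = (i, f)"
        using e unfolding bij_betw_def m_def by (metis atLeastLessThan_iff imageE)
      obtain v where v: "v \<in> U - S" "v mod m = k" "\<forall>u\<in>S. r v u \<longleftrightarrow> u \<in> T"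
        using wit[OF k(1) ifST(3-5)] by blast
      have pc: "part v = i" "col v = f" using v(2) k(2) by (auto simp: part_def col_def)
      have "\<forall>u\<in>S. adj G v u \<longleftrightarrow> u \<in> T" using v adjUU pc(1) ifST by blast
      then show ?thesis using v(1) pc nb by blast
    qed
  qed
  with adjWW show thesis using that by blast
qed

section \<open>The five behaviours of cliques\<close>

lemma ex_less_notin:
  fixes t :: nat
  assumes "finite P" "card P < t"
  shows "\<exists>i<t. i \<notin> P"
proof (rule ccontr)
  assume "\<not> ?thesis"
  then have "{..<t} \<subseteq> P" by auto
  from card_mono[OF assms(1) this] assms(2) show False by simp
qed

lemma ex_avoiding_small_sets:
  assumes "finite Z" "\<And>z. z \<in> Z \<Longrightarrow> finite (B z) \<and> card (B z) \<le> s" "card Z \<le> t" "t * s < card C"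
  shows "\<exists>w\<in>C. \<forall>z\<in>Z. w \<notin> B z"
proof (rule ccontr)
  assume neg: "\<not> ?thesis"
  have "C \<subseteq> (\<Union>z\<in>Z. B z)" using neg by auto
  moreover have "finite (\<Union>z\<in>Z. B z)" using assms(1,2) by auto
  ultimately have "card C \<le> card (\<Union>z\<in>Z. B z)" by (intro card_mono)
  also have "\<dots> \<le> (\<Sum>z\<in>Z. card (B z))" using card_UN_le[OF assms(1)] .
  also have "\<dots> \<le> card Z * s" using assms(2) sum_bounded_above[of Z "\<lambda>z. card (B z)" s] by simp
  also have "\<dots> \<le> t * s" using assms(3) by simp
  finally show False using assms(4) by simp
qed

text \<open>With an empty frame every clique has at most \<open>Suc s\<close> vertices, so
  genericity yields a vertex joined to none of them.\<close>

lemma realize_phiC1: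
  "\<exists>G. is_graph G \<and> ext_prop s G \<and> phiC1 G"
proof -
  obtain G V0 part where "framed_graph G (Suc s) V0 {} part (\<lambda>_. {{}})"
    using framed_graph_exists[of "{}" "Suc s" "\<lambda>_. {{}}" "\<lambda>_ _. False" 0 "{}"] by auto
  then interpret framed_graph G "Suc s" V0 "{}" part "\<lambda>_. {{}}" .
  have "ext_prop s G"
  proof (rule ext_prop_if_rich)
    fix P :: "nat set" and S T :: "nat set"
    assume a: "S \<subseteq> {}" "card P + card S \<le> s" "finite P" "T \<subseteq> S"
    then have "card P < Suc s" by simp
    from ex_less_notin[OF a(3) this] a
    show "\<exists>i<Suc s. i \<notin> P \<and> (\<exists>f\<in>{{}}. f \<inter> S = T)" by auto
  qed simp
  moreover have "phiC1 G"
    unfolding phiC1_def using phiC_if_avoiding[of _ 0 "{}"] by auto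
  ultimately show ?thesis using graph by blast
qed

context framed_graph
begin

text \<open>Adjacent vertices with neighbourhoods \<open>{a}\<close> and \<open>{b}\<close> have no
  common neighbour in the frame. A maximal clique containing both misses \<open>W\<close>, so a
  vertex with neighbourhood \<open>{a}\<close> can avoid it.\<close>

lemma not_phiC2_if_singletons:
  assumes t: "2 \<le> t" and ab: "{a} \<in> F 0" "{b} \<in> F 1" "a \<noteq> b"
  shows "\<not> phiC2 G"
proof -
  obtain z1 where z1: "z1 \<in> V0" "part z1 = 0" "{w\<in>W. adj G z1 w} = {a}"
    using generic[of 0 "{a}" "{}" "{}"] t ab by auto
  obtain z2 where z2: "z2 \<in> V0" "z2 \<noteq> z1" "{w\<in>W. adj G z2 w} = {b}" "adj G z2 z1"
    using generic[of 1 "{b}" "{z1}" "{z1}"] t ab z1 by auto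
  have "cl G {z1, z2}" using z2(4) adj_sym unfolding cl_def by auto
  from maxcl_extend[OF graph _ this] z1 z2 verts
  obtain X where X: "{z1, z2} \<subseteq> X" "X \<subseteq> verts G" "maxcl G X" by auto
  then have cl: "cl G X" by (simp add: maxcl_def)
  have "X \<inter> W = {}"
  proof (rule ccontr)
    assume "X \<inter> W \<noteq> {}"
    then obtain w where w: "w \<in> X" "w \<in> W" by blast
    then have "w \<noteq> z1" "w \<noteq> z2" using z1 z2 verts by auto
    then have "adj G z1 w" "adj G z2 w" using cl X(1) w unfolding cl_def by auto
    then have "w = a" "w = b" using z1(3) z2(3) w by auto
    then show False using ab by simp
  qed
  moreover have "a \<in> W" using z1(3) by blast
  ultimately have "phiC G X" using phiC_if_avoiding[OF X(2) cl, of 0 "{a}"] t ab by auto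
  then show ?thesis using X unfolding phiC2_def by blast
qed

lemma not_phiC_W:
  assumes "\<And>i. i < t \<Longrightarrow> {} \<notin> F i"
  shows "\<not> phiC G W"
proof
  assume "phiC G W"
  then obtain z where z: "z \<in> V0" "\<forall>x\<in>W. \<not> adj G z x" unfolding phiC_def verts by auto
  then have "{w\<in>W. adj G z w} = {}" by auto
  then show False using nbhd[OF z(1)] assms[OF part_less[OF z(1)]] by metis
qed

end

text \<open>\<open>W\<close> is a clique and the neighbourhoods are the nonempty proper subsets: only \<open>W\<close> itself dominates.\<close>

lemma realize_not_phiC1_not_phiC2_phiC3:
  assumes s: "0 < s"
  shows "\<exists>G. is_graph G \<and> ext_prop s G \<and> \<not> phiC1 G \<and> \<not> phiC2 G \<and> phiC3 G"
proof -
  \<comment> \<open>Beyond the at most \<open>s\<close> vertices of \<open>S\<close>, one vertex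
    makes a neighbourhood nonempty and another keeps it proper.\<close>
  define W where "W = {..<s + 2}"
  define F where "F = (\<lambda>_ :: nat. Pow W - {{}, W})"
  have F: "f \<in> F i \<longleftrightarrow> f \<subseteq> W \<and> f \<noteq> {} \<and> f \<noteq> W" for f i by (auto simp: F_def)
  have sing: "{w} \<in> F i" if "w \<in> W" for w i
  proof -
    have "card {w} < card W" using s by (simp add: W_def)
    then have "{w} \<noteq> W" by (metis less_irrefl)
    then show ?thesis using that unfolding F by simp
  qed
  have W01: "0 \<in> W" "1 \<in> W" "finite W" by (auto simp: W_def)
  obtain G V0 part where fr: "framed_graph G (Suc s) V0 W part F"
    and adjW: "\<And>u v. u \<in> W \<Longrightarrow> v \<in> W \<Longrightarrow> adj G u v \<longleftrightarrow> u \<noteq> v"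
    using framed_graph_exists[OF W01(3), of "Suc s" F "(\<noteq>)" 0 "{0}"] sing[OF W01(1)] F_def
    by (metis Diff_subset zero_less_Suc)
  interpret framed_graph G "Suc s" V0 W part F by (rule fr)
  have clW: "cl G W" "W \<subseteq> verts G" using adjW verts by (auto simp: cl_def)
  have "ext_prop s G"
  proof (rule ext_prop_if_rich)
    fix P S T :: "nat set"
    assume a: "S \<subseteq> W" "card P + card S \<le> s" "finite P" "T \<subseteq> S"
    then have "card P < Suc s" by simp
    then obtain i where i: "i < Suc s" "i \<notin> P" using ex_less_notin[OF a(3)] by blast
    obtain w where w: "w < s + 2" "w \<notin> S"
      using ex_less_notin[of S "s + 2"] a finite_subset[OF a(1) W01(3)] by auto
    have "card (insert w S) < s + 2" using a W01 finite_subset[OF a(1)] by (simp add: card_insert_if)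
    then obtain w' where w': "w' < s + 2" "w' \<notin> insert w S"
      using ex_less_notin[of "insert w S" "s + 2"] finite_subset[OF a(1) W01(3)] by auto
    have "insert w T \<in> F i" unfolding F using a w w' by (auto simp: W_def)
    moreover have "insert w T \<inter> S = T" using w a by auto
    ultimately show "\<exists>i<Suc s. i \<notin> P \<and> (\<exists>f\<in>F i. f \<inter> S = T)" using i by blast
  qed simp
  moreover have "\<not> phiC1 G"
    using not_phiC_W clW unfolding phiC1_def F by blast
  moreover have "\<not> phiC2 G"
    using not_phiC2_if_singletons[of 0 1] sing W01 s by auto
  moreover have "phiC3 G"
    unfolding phiC3_def
  proof (intro allI impI)
    fix X assume X: "X \<subseteq> verts G" and c: "cl G X \<and> \<not> phiC G X"
    have "W \<subseteq> X"
    proof (rule ccontr)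
      assume n: "\<not> W \<subseteq> X"
      \<comment> \<open>\<open>W - X\<close> avoids \<open>X\<close>, but is the forbidden set
        \<open>W\<close> when \<open>X\<close> misses the frame; then a singleton serves.\<close>
      have "\<exists>f\<in>F 0. f \<inter> X = {}"
      proof (cases "X \<inter> W = {}")
        case True
        then show ?thesis using sing[OF W01(1), of 0] W01 by (intro bexI[of _ "{0}"]) auto
      next
        case False
        then have "W - X \<in> F 0" using n unfolding F by blast
        then show ?thesis by blast
      qed
      then show False using phiC_if_avoiding[of X 0] X c by blast
    qed
    show "maxcl G X" unfolding maxcl_def
    proof (intro conjI notI)
      show "cl G X" using c by simp
      assume "\<exists>z\<in>verts G - X. \<forall>x\<in>X. adj G z x"
      then obtain z where z: "z \<in> V0" "\<forall>x\<in>X. adj G z x" using \<open>W \<subseteq> X\<close> verts by auto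
      then have "{w\<in>W. adj G z w} = W" using \<open>W \<subseteq> X\<close> by auto
      then show False using nbhd[OF z(1)] unfolding F by simp
    qed
  qed
  ultimately show ?thesis using graph by blast
qed

text \<open>As before, but a neighbourhood may be all of \<open>W\<close>, so the dominating clique \<open>W\<close> is no longer maximal.\<close>

lemma realize_not_phiC1_not_phiC2_not_phiC3:
  assumes s: "0 < s"
  shows "\<exists>G. is_graph G \<and> ext_prop s G \<and> \<not> phiC1 G \<and> \<not> phiC2 G \<and> \<not> phiC3 G"
proof -
  \<comment> \<open>One vertex beyond \<open>S\<close> suffices, since a neighbourhood need only be
    nonempty.\<close>
  define W where "W = {..<s + 1}"
  define F where "F = (\<lambda>_ :: nat. Pow W - {{}})"
  have F: "f \<in> F i \<longleftrightarrow> f \<subseteq> W \<and> f \<noteq> {}" for f i by (auto simp: F_def)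
  have W01: "0 \<in> W" "1 \<in> W" "finite W" using s by (auto simp: W_def)
  have sing: "{w} \<in> F i" if "w \<in> W" for w i using that unfolding F by simp
  obtain G V0 part where fr: "framed_graph G (Suc s) V0 W part F"
    and adjW: "\<And>u v. u \<in> W \<Longrightarrow> v \<in> W \<Longrightarrow> adj G u v \<longleftrightarrow> u \<noteq> v"
    using framed_graph_exists[OF W01(3), of "Suc s" F "(\<noteq>)" 0 "{0}"] sing[OF W01(1)] F_def
    by (metis Diff_subset zero_less_Suc)
  interpret framed_graph G "Suc s" V0 W part F by (rule fr)
  have clW: "cl G W" "W \<subseteq> verts G" using adjW verts by (auto simp: cl_def)
  have "ext_prop s G"
  proof (rule ext_prop_if_rich)
    fix P S T :: "nat set"
    assume a: "S \<subseteq> W" "card P + card S \<le> s" "finite P" "T \<subseteq> S"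
    then have "card P < Suc s" by simp
    then obtain i where i: "i < Suc s" "i \<notin> P" using ex_less_notin[OF a(3)] by blast
    obtain w where w: "w < s + 1" "w \<notin> S"
      using ex_less_notin[of S "s + 1"] a finite_subset[OF a(1) W01(3)] by auto
    have "insert w T \<in> F i" unfolding F using a w by (auto simp: W_def)
    moreover have "insert w T \<inter> S = T" using w a by auto
    ultimately show "\<exists>i<Suc s. i \<notin> P \<and> (\<exists>f\<in>F i. f \<inter> S = T)" using i by blast
  qed simp
  moreover have domW: "\<not> phiC G W" using not_phiC_W unfolding F by blast
  moreover have "\<not> phiC1 G" using domW clW unfolding phiC1_def by blast
  moreover have "\<not> phiC2 G"
    using not_phiC2_if_singletons[of 0 1] sing W01 s by auto
  moreover have "\<not> maxcl G W"
    using not_maxcl_if_containing[OF clW(2,1), of 0 W] W01 verts F by (auto simp: Int_commute)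
  then have "\<not> phiC3 G" using domW clW unfolding phiC3_def by blast
  ultimately show ?thesis using graph by blast
qed

text \<open>\<open>W\<close> is a large clique and each neighbourhood misses few vertices, so any \<open>t + 1\<close> of them have a common element,
  which a maximal clique must contain.\<close>

lemma realize_phiC2_not_phiC3:
  "\<exists>G. is_graph G \<and> ext_prop s G \<and> phiC2 G \<and> \<not> phiC3 G"
proof -
  define t where "t = Suc s"
  \<comment> \<open>One more than the exceptions of \<open>t + 1\<close> vertices: up to
    \<open>t\<close> from the clique, and possibly the vertex \<open>z\<close> that it fails to
    dominate.\<close>
  define W where "W = {..<Suc t * s + 1}"
  define F where "F = (\<lambda>_ :: nat. {f. f \<subseteq> W \<and> card (W - f) \<le> s})"
  have F: "f \<in> F i \<longleftrightarrow> f \<subseteq> W \<and> card (W - f) \<le> s" for f i by (auto simp: F_def)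
  have finW: "finite W" and cardW: "card W = Suc t * s + 1" by (auto simp: W_def)
  have "W \<in> F 0" by (simp add: F)
  obtain G V0 part where fr: "framed_graph G t V0 W part F"
    and adjW: "\<And>u v. u \<in> W \<Longrightarrow> v \<in> W \<Longrightarrow> adj G u v \<longleftrightarrow> u \<noteq> v"
    using framed_graph_exists[OF finW, of t F "(\<noteq>)" 0 W] \<open>W \<in> F 0\<close> unfolding F_def t_def
    by (auto simp: subset_iff)
  interpret framed_graph G t V0 W part F by (rule fr)
  have clW: "cl G W" "W \<subseteq> verts G" using adjW verts by (auto simp: cl_def)
  have "ext_prop s G"
  proof (rule ext_prop_if_rich)
    fix P S T :: "nat set"
    assume a: "S \<subseteq> W" "card P + card S \<le> s" "finite P" "T \<subseteq> S"
    then have "card P < t" by (simp add: t_def)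
    then obtain i where i: "i < t" "i \<notin> P" using ex_less_notin[OF a(3)] by blast
    have "W - (W - (S - T)) = S - T" using a by auto
    moreover have "card (S - T) \<le> s"
      using a card_mono[of S "S - T"] finite_subset[OF a(1) finW] by auto
    ultimately have "W - (S - T) \<in> F i" unfolding F by auto
    moreover have "(W - (S - T)) \<inter> S = T" using a by auto
    ultimately show "\<exists>i<t. i \<notin> P \<and> (\<exists>f\<in>F i. f \<inter> S = T)" using i by blast
  qed (simp add: t_def)
  moreover have "phiC2 G"
    unfolding phiC2_def
  proof (intro allI impI notI)
    fix X assume X: "X \<subseteq> verts G" "maxcl G X" and "phiC G X"
    then obtain z where z: "z \<in> verts G" "z \<notin> X" "\<forall>x\<in>X. \<not> adj G z x" unfolding phiC_def by blast
    have cl: "cl G X" using X by (simp add: maxcl_def)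
    define Z where "Z = (X \<inter> V0) \<union> ({z} \<inter> V0)"
    have ZV: "Z \<subseteq> V0" by (auto simp: Z_def)
    have finZ: "finite Z" using finite_V0 by (auto simp: Z_def)
    have "card Z \<le> card (X \<inter> V0) + card ({z} \<inter> V0)" unfolding Z_def by (rule card_Un_le)
    moreover have "card ({z} \<inter> V0) \<le> 1" using card_mono[of "{z}" "{z} \<inter> V0"] by auto
    ultimately have cardZ: "card Z \<le> Suc t" using clique_inter_V0(2)[OF cl] by linarith
    have "\<exists>w\<in>W. \<forall>v\<in>Z. w \<notin> W - {w\<in>W. adj G v w}"
    proof (rule ex_avoiding_small_sets[OF finZ _ cardZ])
      show "finite (W - {w\<in>W. adj G v w}) \<and> card (W - {w\<in>W. adj G v w}) \<le> s" if "v \<in> Z" for v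
        using nbhd[of v] that ZV finW unfolding F by blast
      show "Suc t * s < card W" by (simp add: cardW)
    qed
    then obtain w where w: "w \<in> W" "\<forall>v\<in>Z. adj G v w" using finW by auto
    have "w \<in> X"
    proof (rule ccontr)
      assume "w \<notin> X"
      have "adj G w x" if "x \<in> X" for x
      proof (cases "x \<in> V0")
        case True
        then show ?thesis using w that adj_sym by (auto simp: Z_def)
      next
        case False
        then have "x \<in> W" using that X verts by auto
        then show ?thesis using adjW[OF w(1)] that \<open>w \<notin> X\<close> by auto
      qed
      then show False using X(2) \<open>w \<notin> X\<close> w(1) verts unfolding maxcl_def by blast
    qed
    then have nad: "\<not> adj G z w" "z \<noteq> w" using z by auto
    show False
    proof (cases "z \<in> V0")
      case True
      then show False using w nad by (auto simp: Z_def)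
    next
      case False
      then have "z \<in> W" using z verts by auto
      then show False using adjW[OF _ w(1)] nad by auto
    qed
  qed
  moreover have "\<not> phiC3 G"
  proof -
    have "\<not> phiC G W" using cardW by (intro not_phiC_W) (auto simp: F)
    moreover have "\<not> maxcl G W"
      using not_maxcl_if_containing[OF clW(2,1), of 0 W] verts F by (auto simp: Int_commute t_def)
    ultimately show ?thesis using clW unfolding phiC3_def by blast
  qed
  ultimately show ?thesis using graph by blast
qed

section \<open>A graph whose maximal cliques are exactly its dominating cliques\<close>

lemma labelled_set_exists:
  assumes L: "finite L"
  obtains W :: "nat set" and lab :: "nat \<Rightarrow> 'a"
  where "finite W" "\<And>w. w \<in> W \<Longrightarrow> lab w \<in> L" "\<And>l. l \<in> L \<Longrightarrow> card {w\<in>W. lab w = l} = N"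
proof -
  define M where "M = L \<times> {..<N}"
  have "finite M" using L by (simp add: M_def)
  then obtain g where g: "bij_betw g {0..<card M} M" using ex_bij_betw_nat_finite by blast
  have "card {w\<in>{0..<card M}. fst (g w) = l} = N" if "l \<in> L" for l
  proof -
    have "g ` {w\<in>{0..<card M}. fst (g w) = l} = {p \<in> g ` {0..<card M}. fst p = l}" by auto
    also have "\<dots> = {l} \<times> {..<N}" using bij_betw_imp_surj_on[OF g] that by (auto simp: M_def)
    finally have "bij_betw g {w\<in>{0..<card M}. fst (g w) = l} ({l} \<times> {..<N})"
      by (intro bij_betw_subset[OF g]) auto
    then show ?thesis using bij_betw_same_card by fastforce
  qed
  moreover have "fst (g w) \<in> L" if "w \<in> {0..<card M}" for w
    using bij_betwE[OF g] that by (metis M_def SigmaE2 prod.collapse)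
  ultimately show thesis using that[of "{0..<card M}" "fst \<circ> g"] by auto
qed

text \<open>\<open>W\<close> consists of two copies of a complete \<open>t\<close>-partite graph whose parts are the rows, without edges between
  the copies. A cell of \<open>W\<close> has a copy, a row, an owner (a part of \<open>V0\<close>) and a kind: dense (\<open>True\<close>) or sparse
  (\<open>False\<close>). A vertex of part \<open>j\<close> is adjacent to all cells owned by \<open>j\<close> and, in each copy, to one full row;
  elsewhere it is adjacent to almost all dense and to almost no sparse cells.

  A clique \<open>Z \<union> K\<close> with \<open>Z\<close> in \<open>V0\<close> and \<open>K\<close> in one copy of \<open>W\<close> is maximal, and equally dominating, exactly if
  \<open>K\<close> hits every row and \<open>Z\<close> every part. If \<open>K\<close> misses a row, the dense cells of that row extend the clique
  while a vertex of \<open>V0\<close> full on that row can avoid it. If \<open>K\<close> hits all rows it dominates \<open>V0\<close> and its own copy;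
  the other copy is dominated through ownership when \<open>Z\<close> is full, and if \<open>Z\<close> misses part \<open>i\<close>, some sparse cell
  owned by \<open>i\<close> is not dominated while a vertex of part \<open>i\<close> extends the clique.\<close>

lemma realize_phiC2_phiC3:
  assumes s: "0 < s"
  shows "\<exists>G. is_graph G \<and> ext_prop s G \<and> phiC2 G \<and> phiC3 G"
proof -
  define t where "t = Suc s"
  define L where "L = (UNIV :: bool set) \<times> {..<t} \<times> {..<t} \<times> (UNIV :: bool set)"
  have "finite L" by (simp add: L_def)
  \<comment> \<open>Each cell is just large enough that \<open>t\<close> vertices with at most
    \<open>s\<close> exceptions each leave one element over.\<close>
  then obtain W :: "nat set" and lab where finW: "finite W" and lab: "\<And>w. w \<in> W \<Longrightarrow> lab w \<in> L"
    and cardlab: "\<And>l. l \<in> L \<Longrightarrow> card {w\<in>W. lab w = l} = Suc (t * s)"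
    by (rule labelled_set_exists[of L "Suc (t * s)"]) (rule that)
  define cop where "cop w = fst (lab w)" for w
  define row where "row w = fst (snd (lab w))" for w
  define own where "own w = fst (snd (snd (lab w)))" for w
  define knd where "knd w = snd (snd (snd (lab w)))" for w
  define cell where "cell c r i k = {w\<in>W. cop w = c \<and> row w = r \<and> own w = i \<and> knd w = k}" for c r i k
  have row: "row w < t" and own: "own w < t" if "w \<in> W" for w
    using lab[OF that] by (auto simp: row_def own_def L_def)
  have cell: "finite (cell c r i k)" "card (cell c r i k) = Suc (t * s)" if "r < t" "i < t" for c r i k
  proof -
    have "cell c r i k = {w\<in>W. lab w = (c, r, i, k)}"
      by (simp add: cell_def cop_def row_def own_def knd_def prod_eq_iff)
    then show "card (cell c r i k) = Suc (t * s)" using cardlab that by (simp add: L_def)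
    show "finite (cell c r i k)" using finW by (simp add: cell_def)
  qed
  define aW where "aW u v \<longleftrightarrow> cop u = cop v \<and> row u \<noteq> row v" for u v
  define adm where "adm j f c \<rho> \<longleftrightarrow> \<rho> < t \<and> (\<forall>w\<in>W. cop w = c \<longrightarrow> row w = \<rho> \<longrightarrow> w \<in> f) \<and>
      (\<forall>r<t. \<forall>i<t. r \<noteq> \<rho> \<longrightarrow> i \<noteq> j \<longrightarrow>
         card (cell c r i True - f) \<le> s \<and> card (cell c r i False \<inter> f) \<le> s)" for j f c \<rho>
  define F where "F j = {f. f \<subseteq> W \<and> (\<forall>w\<in>W. own w = j \<longrightarrow> w \<in> f) \<and> (\<forall>c. \<exists>\<rho>. adm j f c \<rho>)}" for j
  \<comment> \<open>The common shape of the neighbourhoods used below, where \<open>B\<close> lists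
    the dense exceptions and \<open>A\<close> the sparse ones.\<close>
  have F_memI: "{w\<in>W. own w = j \<or> row w = \<rho> (cop w) \<or> (knd w \<and> w \<notin> B) \<or> (\<not> knd w \<and> w \<in> A)} \<in> F j" (is "?f \<in> _")
    if \<rho>: "\<And>c. \<rho> c < t" and A: "\<And>c r i k. r < t \<Longrightarrow> i < t \<Longrightarrow> card (cell c r i k \<inter> A) \<le> s"
      and B: "\<And>c r i k. r < t \<Longrightarrow> i < t \<Longrightarrow> card (cell c r i k \<inter> B) \<le> s" for j \<rho> A B
  proof -
    have "card (cell c r i True - ?f) \<le> s \<and> card (cell c r i False \<inter> ?f) \<le> s"
      if "r < t" "i < t" "r \<noteq> \<rho> c" "i \<noteq> j" for c r i
    proof -
      have "cell c r i True - ?f = cell c r i True \<inter> B" "cell c r i False \<inter> ?f = cell c r i False \<inter> A"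
        using that by (auto simp: cell_def)
      then show ?thesis using A B that by simp
    qed
    then have "adm j ?f c (\<rho> c)" for c unfolding adm_def using \<rho> by simp
    then show ?thesis unfolding F_def by blast
  qed
  have "\<exists>f. f \<in> F 0" using F_memI[of "\<lambda>_. 0" "{}" "{}" 0] by (auto simp: t_def)
  then obtain f0 where f0: "f0 \<in> F 0" by blast
  obtain G V0 part where fr: "framed_graph G t V0 W part F"
    and adjW: "\<And>u v. u \<in> W \<Longrightarrow> v \<in> W \<Longrightarrow> adj G u v \<longleftrightarrow> cop u = cop v \<and> row u \<noteq> row v"
  proof (rule framed_graph_exists[OF finW, of t F aW 0 f0])
    show "F i \<subseteq> Pow W" for i by (auto simp: F_def)
    show "aW v u" if "aW u v" for u v using that by (auto simp: aW_def)
    show "\<not> aW u u" for u by (simp add: aW_def)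
    show "0 < t" by (simp add: t_def)
    show "f0 \<in> F 0" by fact
    fix G V0 part assume "framed_graph G t V0 W part F" "\<And>u v. u \<in> W \<Longrightarrow> v \<in> W \<Longrightarrow> adj G u v \<longleftrightarrow> aW u v"
    then show thesis using that by (simp add: aW_def)
  qed
  interpret framed_graph G t V0 W part F by (rule fr)
  define N where "N v = {w\<in>W. adj G v w}" for v
  have N: "N v \<in> F (part v)" if "v \<in> V0" for v using nbhd[OF that] by (simp add: N_def)
  have N_own: "w \<in> N v" if "v \<in> V0" "w \<in> W" "own w = part v" for v w
    using N[OF that(1)] that by (auto simp: F_def)
  define \<rho> where "\<rho> v c = (SOME r. adm (part v) (N v) c r)" for v c
  have adm: "adm (part v) (N v) c (\<rho> v c)" if "v \<in> V0" for v c
  proof -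
    have "\<exists>r. adm (part v) (N v) c r" using N[OF that] by (simp add: F_def)
    then show ?thesis unfolding \<rho>_def by (rule someI_ex)
  qed
  have \<rho>: "\<rho> v c < t" if "v \<in> V0" for v c
    using adm[OF that, of c] by (simp add: adm_def)
  have full: "w \<in> N v" if "v \<in> V0" "w \<in> W" "row w = \<rho> v (cop w)" for v w
    using adm[OF that(1), of "cop w"] that by (simp add: adm_def)
  have sparse: "card (cell c r i True - N v) \<le> s \<and> card (cell c r i False \<inter> N v) \<le> s"
    if "v \<in> V0" "r < t" "i < t" "r \<noteq> \<rho> v c" "i \<noteq> part v" for v c r i
    using adm[OF that(1), of c] that by (simp add: adm_def)
  have ext: "ext_prop s G"
  proof (rule ext_prop_if_rich)
    fix P S T :: "nat set"
    assume a: "S \<subseteq> W" "card P + card S \<le> s" "finite P" "T \<subseteq> S"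
    have finS: "finite S" using finite_subset[OF a(1) finW] .
    \<comment> \<open>The forced part of a neighbourhood, cells owned by \<open>j\<close> and a full
      row, must stay clear of \<open>S\<close>; \<open>t = Suc s\<close> leaves an owner and a row
      free.\<close>
    have "card (P \<union> own ` S) \<le> card P + card S"
      using card_Un_le[of P "own ` S"] card_image_le[OF finS, of own] by linarith
    then have "card (P \<union> own ` S) < t" using a(2) by (simp add: t_def)
    then obtain j where j: "j < t" "j \<notin> P \<union> own ` S"
      using ex_less_notin[of "P \<union> own ` S" t] a(3) finS by auto
    have "card (row ` S) < t" using card_image_le[OF finS, of row] a(2) by (simp add: t_def)
    then obtain r where r: "r < t" "r \<notin> row ` S"
      using ex_less_notin[of "row ` S" t] finS by auto
    have bound: "card (cell c r' i k \<inter> A) \<le> s" if "A \<subseteq> S" for A c r' i k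
    proof -
      have "card (cell c r' i k \<inter> A) \<le> card S" using that finS by (intro card_mono) auto
      then show ?thesis using a(2) by linarith
    qed
    define f where "f = {w\<in>W. own w = j \<or> row w = (\<lambda>_. r) (cop w) \<or> (knd w \<and> w \<notin> S - T) \<or> (\<not> knd w \<and> w \<in> T)}"
    have "f \<in> F j" unfolding f_def using r a(4) by (intro F_memI bound) auto
    moreover have "f \<inter> S = T" using j r a(1,4) by (auto simp: f_def)
    ultimately show "\<exists>i<t. i \<notin> P \<and> (\<exists>f\<in>F i. f \<inter> S = T)" using j by blast
  qed (simp add: t_def)
  have iff: "maxcl G X \<longleftrightarrow> \<not> phiC G X" if X: "X \<subseteq> verts G" "cl G X" for X
  proof -
    define Z where "Z = X \<inter> V0"
    define K where "K = X \<inter> W"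
    have ZV: "Z \<subseteq> V0" and KW: "K \<subseteq> W" and XZK: "X = Z \<union> K" using X verts by (auto simp: Z_def K_def)
    have finZ: "finite Z" and finK: "finite K" using finite_V0 finW by (auto simp: Z_def K_def)
    have cardZ: "card Z \<le> t" and injZ: "inj_on part Z" using clique_inter_V0[OF X(2)] by (auto simp: Z_def)
    have K2: "cop u = cop v \<and> row u \<noteq> row v" if "u \<in> K" "v \<in> K" "u \<noteq> v" for u v
    proof -
      have "adj G u v" using X(2) that unfolding cl_def K_def by simp
      then show ?thesis using adjW[of u v] that KW by auto
    qed
    obtain c where c: "\<And>w. w \<in> K \<Longrightarrow> cop w = c"
    proof (cases "K = {}")
      case True
      then show thesis using that by simp
    next
      case False
      then obtain k where "k \<in> K" by blast
      then show thesis using that[of "cop k"] K2 by metis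
    qed
    have injK: "inj_on row K" using K2 by (auto simp: inj_on_def)
    \<comment> \<open>Two vertices of \<open>K\<close> in one cell would share a row. As
      \<open>0 < s\<close>, \<open>K\<close> can serve as an exception set in
      \<open>F_memI\<close>.\<close>
    have K1: "card (cell c r i k \<inter> K) \<le> s" for c r i k
    proof -
      have "u = v" if "u \<in> cell c r i k \<inter> K" "v \<in> cell c r i k \<inter> K" for u v
        using K2[of u v] that by (auto simp: cell_def)
      then have "card (cell c r i k \<inter> K) \<le> Suc 0" using finK by (subst card_le_Suc0_iff_eq) auto
      then show ?thesis using s by linarith
    qed
    have rowK: "row ` K \<subseteq> {..<t}" using row KW by auto
    show ?thesis
    proof (cases "\<exists>r<t. r \<notin> row ` K")
      case True
      then obtain r where r: "r < t" "r \<notin> row ` K" by blast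
      have "\<exists>w\<in>cell c r 0 True. \<forall>z\<in>Z. w \<notin> cell c r 0 True - N z"
      proof (rule ex_avoiding_small_sets[OF finZ _ cardZ])
        show "t * s < card (cell c r 0 True)" using cell(2)[OF r(1), of 0] by (simp add: t_def)
        fix z assume "z \<in> Z"
        then have z: "z \<in> V0" using ZV by auto
        show "finite (cell c r 0 True - N z) \<and> card (cell c r 0 True - N z) \<le> s"
        proof (cases "r = \<rho> z c \<or> part z = 0")
          case True
          then have "cell c r 0 True - N z = {}" using full[OF z] N_own[OF z] by (auto simp: cell_def)
          then show ?thesis by (metis card.empty finite.emptyI zero_le)
        next
          case False
          then show ?thesis using sparse[OF z r(1), of 0 c] cell(1)[OF r(1), of 0] by (auto simp: t_def)
        qed
      qed
      then obtain w where w: "w \<in> W" "cop w = c" "row w = r" "\<forall>z\<in>Z. w \<in> N z" by (auto simp: cell_def)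
      have "w \<notin> X" using w r verts ZV by (auto simp: XZK)
      moreover have "adj G w x" if "x \<in> X" for x
      proof (cases "x \<in> K")
        case True
        then show ?thesis using adjW[OF w(1), of x] KW c w r by auto
      next
        case False
        then have "x \<in> Z" using that XZK by auto
        then show ?thesis using w(4) adj_sym by (auto simp: N_def)
      qed
      ultimately have nm: "\<not> maxcl G X" using w(1) verts unfolding maxcl_def by blast
      have "row ` K \<subseteq> {..<t} - {r}" using rowK r by auto
      then have "card (row ` K) \<le> card ({..<t} - {r})" by (intro card_mono) auto
      then have "card (row ` K) < t" using r by simp
      then have "card (own ` K) < t" using card_image[OF injK] card_image_le[OF finK, of own] by linarith
      then obtain j where j: "j < t" "j \<notin> own ` K" using ex_less_notin[of "own ` K" t] finK by auto
      define f where "f = {w\<in>W. own w = j \<or> row w = (\<lambda>_. r) (cop w) \<or> (knd w \<and> w \<notin> K) \<or> (\<not> knd w \<and> w \<in> {})}"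
      have "f \<in> F j" unfolding f_def using r K1 by (intro F_memI) auto
      moreover have "f \<inter> X = {}" using j r KW verts ZV by (auto simp: f_def XZK)
      ultimately have "phiC G X" using phiC_if_avoiding[OF X j(1)] by blast
      with nm show ?thesis by simp
    next
      case False
      then have hitall: "\<And>r. r < t \<Longrightarrow> \<exists>w\<in>K. row w = r" by (metis imageE)
      show ?thesis
      proof (cases "\<exists>i<t. i \<notin> part ` Z")
        case True
        then obtain i where i: "i < t" "i \<notin> part ` Z" by blast
        define f where "f = {w\<in>W. own w = i \<or> row w = (\<lambda>_. 0) (cop w) \<or> (knd w \<and> w \<notin> {}) \<or> (\<not> knd w \<and> w \<in> K)}"
        have "f \<in> F i" unfolding f_def using K1 by (intro F_memI) (auto simp: t_def)
        moreover have "X \<inter> W \<subseteq> f" by (auto simp: f_def K_def)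
        ultimately have nm: "\<not> maxcl G X" using not_maxcl_if_containing[OF X i(1)] i(2) by (auto simp: Z_def)
        \<comment> \<open>Now \<open>Z\<close> has fewer than \<open>t\<close> vertices, so some row
          of the other copy is the full row of none of them. Each is adjacent to few vertices of the
          sparse cell owned by \<open>i\<close> in that row.\<close>
        have "part ` Z \<subseteq> {..<t} - {i}" using part_less ZV i by auto
        then have "card (part ` Z) \<le> card ({..<t} - {i})" by (intro card_mono) auto
        then have "card Z < t" using i card_image[OF injZ] by simp
        then have "card ((\<lambda>z. \<rho> z (\<not> c)) ` Z) < t" using card_image_le[OF finZ] le_less_trans by blast
        then obtain r where r: "r < t" "r \<notin> (\<lambda>z. \<rho> z (\<not> c)) ` Z"
          using ex_less_notin finZ by (metis finite_imageI)
        have "\<exists>w\<in>cell (\<not> c) r i False. \<forall>z\<in>Z. w \<notin> cell (\<not> c) r i False \<inter> N z"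
        proof (rule ex_avoiding_small_sets[OF finZ _ cardZ])
          show "t * s < card (cell (\<not> c) r i False)" using cell(2)[OF r(1) i(1)] by simp
          fix z assume "z \<in> Z"
          then have "z \<in> V0" "r \<noteq> \<rho> z (\<not> c)" "i \<noteq> part z" using ZV r(2) i(2) by blast+
          then show "finite (cell (\<not> c) r i False \<inter> N z) \<and> card (cell (\<not> c) r i False \<inter> N z) \<le> s"
            using sparse[OF _ r(1) i(1)] cell(1)[OF r(1) i(1)] by simp
        qed
        then obtain w where w: "w \<in> W" "cop w \<noteq> c" "\<forall>z\<in>Z. w \<notin> N z" by (auto simp: cell_def)
        have "w \<notin> X" using w c verts ZV by (auto simp: XZK)
        moreover have "\<not> adj G w x" if "x \<in> X" for x
        proof (cases "x \<in> K")
          case True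
          then show ?thesis using adjW[OF w(1), of x] KW c w by auto
        next
          case False
          then have "x \<in> Z" using that XZK by auto
          then show ?thesis using w adj_sym by (auto simp: N_def)
        qed
        ultimately have "phiC G X" using w(1) verts unfolding phiC_def by blast
        with nm show ?thesis by simp
      next
        case False
        then have fullZ: "\<And>i. i < t \<Longrightarrow> \<exists>z\<in>Z. part z = i" by (metis imageE)
        have "maxcl G X" unfolding maxcl_def
        proof (intro conjI notI X(2))
          assume "\<exists>v\<in>verts G - X. \<forall>x\<in>X. adj G v x"
          then obtain v where v: "v \<in> verts G" "v \<notin> X" "\<forall>x\<in>X. adj G v x" by blast
          show False
          proof (cases "v \<in> V0")
            case True
            then obtain z where "z \<in> Z" "part z = part v" using fullZ part_less by blast
            then show False using part_indep[OF True, of z] v ZV XZK by auto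
          next
            case False
            then have vW: "v \<in> W" using v verts by auto
            obtain w where w: "w \<in> K" "row w = row v" using hitall[OF row[OF vW]] by blast
            then show False using v adjW[OF vW, of w] KW XZK by auto
          qed
        qed
        moreover have "\<not> phiC G X"
        proof
          assume "phiC G X"
          then obtain v where v: "v \<in> verts G" "v \<notin> X" "\<forall>x\<in>X. \<not> adj G v x" unfolding phiC_def by blast
          show False
          proof (cases "v \<in> V0")
            case True
            obtain w where w: "w \<in> K" "row w = \<rho> v c" using hitall[OF \<rho>[OF True]] by blast
            then have "w \<in> N v" using full[OF True, of w] KW c by auto
            then show False using v w XZK by (auto simp: N_def)
          next
            case False
            then have vW: "v \<in> W" using v verts by auto
            show False
            proof (cases "cop v = c")
              case True
              \<comment> \<open>\<open>0 < s\<close> provides a second row, where \<open>K\<close>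
                has a neighbour of \<open>v\<close>.\<close>
              obtain r where r: "r < t" "r \<noteq> row v" using s ex_less_notin[of "{row v}" t] by (auto simp: t_def)
              obtain w where w: "w \<in> K" "row w = r" using hitall[OF r(1)] by blast
              then show False using v adjW[OF vW, of w] KW XZK r c True by auto
            next
              case False
              obtain z where z: "z \<in> Z" "part z = own v" using fullZ[OF own[OF vW]] by blast
              then have "v \<in> N z" using N_own[of z v] ZV vW by auto
              then show False using v z XZK adj_sym by (auto simp: N_def)
            qed
          qed
        qed
        ultimately show ?thesis by simp
      qed
    qed
  qed
  have "phiC2 G" unfolding phiC2_def using iff by (auto simp: maxcl_def)
  moreover have "phiC3 G" unfolding phiC3_def using iff by blast
  ultimately show ?thesis using graph ext by blast
qed

section \<open>Independent sets by complementation, and the final assembly\<close>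

lemma realize_gcompl:
  assumes "\<exists>G. is_graph G \<and> ext_prop s G \<and> Q (phiC1 G) (phiC2 G) (phiC3 G)"
  shows "\<exists>G. is_graph G \<and> ext_prop s G \<and> Q (phiI1 G) (phiI2 G) (phiI3 G)"
proof -
  obtain G where G: "is_graph G" "ext_prop s G" "Q (phiC1 G) (phiC2 G) (phiC3 G)" using assms by blast
  then show ?thesis
    using phiI123_gcompl[OF G(1)] is_graph_gcompl[OF G(1)] ext_prop_gcompl[OF G(2)]
    by (intro exI[of _ "gcompl G"]) simp
qed

theorem theorem4:
  shows "(\<exists>s::nat. 0 < s \<and>
            (\<forall>G H. is_graph G \<longrightarrow> is_graph H \<longrightarrow> ext_prop s G \<longrightarrow> ext_prop s H \<longrightarrow>
               (phiC1 G \<longleftrightarrow> phiC1 H) \<longrightarrow> (phiC2 G \<longleftrightarrow> phiC2 H) \<longrightarrow> (phiC3 G \<longleftrightarrow> phiC3 H) \<longrightarrow>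
               (phiI1 G \<longleftrightarrow> phiI1 H) \<longrightarrow> (phiI2 G \<longleftrightarrow> phiI2 H) \<longrightarrow> (phiI3 G \<longleftrightarrow> phiI3 H) \<longrightarrow>
               (\<forall>\<phi>. E12 \<phi> \<longrightarrow> (holds_E12 G \<phi> \<longleftrightarrow> holds_E12 H \<phi>))))
       \<and> (\<forall>s::nat. 0 < s \<longrightarrow>
            (\<forall>\<phi> \<in> {phiC1,
                    \<lambda>G. \<not> phiC1 G \<and> \<not> phiC2 G \<and> phiC3 G,
                    \<lambda>G. \<not> phiC1 G \<and> \<not> phiC2 G \<and> \<not> phiC3 G,
                    \<lambda>G. phiC2 G \<and> phiC3 G,
                    \<lambda>G. phiC2 G \<and> \<not> phiC3 G}.
               \<exists>G. is_graph G \<and> ext_prop s G \<and> \<phi> G)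
          \<and> (\<forall>\<phi> \<in> {phiI1,
                    \<lambda>G. \<not> phiI1 G \<and> \<not> phiI2 G \<and> phiI3 G,
                    \<lambda>G. \<not> phiI1 G \<and> \<not> phiI2 G \<and> \<not> phiI3 G,
                    \<lambda>G. phiI2 G \<and> phiI3 G,
                    \<lambda>G. phiI2 G \<and> \<not> phiI3 G}.
               \<exists>G. is_graph G \<and> ext_prop s G \<and> \<phi> G))"
proof (rule conjI)
  show "\<exists>s::nat. 0 < s \<and>
            (\<forall>G H. is_graph G \<longrightarrow> is_graph H \<longrightarrow> ext_prop s G \<longrightarrow> ext_prop s H \<longrightarrow>
               (phiC1 G \<longleftrightarrow> phiC1 H) \<longrightarrow> (phiC2 G \<longleftrightarrow> phiC2 H) \<longrightarrow> (phiC3 G \<longleftrightarrow> phiC3 H) \<longrightarrow>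
               (phiI1 G \<longleftrightarrow> phiI1 H) \<longrightarrow> (phiI2 G \<longleftrightarrow> phiI2 H) \<longrightarrow> (phiI3 G \<longleftrightarrow> phiI3 H) \<longrightarrow>
               (\<forall>\<phi>. E12 \<phi> \<longrightarrow> (holds_E12 G \<phi> \<longleftrightarrow> holds_E12 H \<phi>)))"
  proof (intro exI[of _ 6] conjI allI impI)
    fix G H \<phi>
    assume "is_graph G" "is_graph H" "ext_prop 6 G" "ext_prop 6 H"
      and phi: "phiC1 G \<longleftrightarrow> phiC1 H" "phiC2 G \<longleftrightarrow> phiC2 H" "phiC3 G \<longleftrightarrow> phiC3 H"
        "phiI1 G \<longleftrightarrow> phiI1 H" "phiI2 G \<longleftrightarrow> phiI2 H" "phiI3 G \<longleftrightarrow> phiI3 H"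
      and \<phi>: "E12 \<phi>"
    then have G: "ext_graph G" and H: "ext_graph H" by (simp_all add: ext_graph_def)
    show "holds_E12 G \<phi> \<longleftrightarrow> holds_E12 H \<phi>"
      using E12_transfer[OF G H phi \<phi>]
        E12_transfer[OF H G phi(1)[symmetric] phi(2)[symmetric] phi(3)[symmetric]
          phi(4)[symmetric] phi(5)[symmetric] phi(6)[symmetric] \<phi>] by blast
  qed simp
next
  have C: "\<exists>G. is_graph G \<and> ext_prop s G \<and> phiC1 G"
    "\<exists>G. is_graph G \<and> ext_prop s G \<and> \<not> phiC1 G \<and> \<not> phiC2 G \<and> phiC3 G"
    "\<exists>G. is_graph G \<and> ext_prop s G \<and> \<not> phiC1 G \<and> \<not> phiC2 G \<and> \<not> phiC3 G"
    "\<exists>G. is_graph G \<and> ext_prop s G \<and> phiC2 G \<and> phiC3 G"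
    "\<exists>G. is_graph G \<and> ext_prop s G \<and> phiC2 G \<and> \<not> phiC3 G" if "0 < s" for s
    using that by (intro realize_phiC1 realize_not_phiC1_not_phiC2_phiC3 realize_not_phiC1_not_phiC2_not_phiC3 realize_phiC2_phiC3 realize_phiC2_not_phiC3; simp)+
  have I: "\<exists>G. is_graph G \<and> ext_prop s G \<and> phiI1 G"
    "\<exists>G. is_graph G \<and> ext_prop s G \<and> \<not> phiI1 G \<and> \<not> phiI2 G \<and> phiI3 G"
    "\<exists>G. is_graph G \<and> ext_prop s G \<and> \<not> phiI1 G \<and> \<not> phiI2 G \<and> \<not> phiI3 G"
    "\<exists>G. is_graph G \<and> ext_prop s G \<and> phiI2 G \<and> phiI3 G"
    "\<exists>G. is_graph G \<and> ext_prop s G \<and> phiI2 G \<and> \<not> phiI3 G" if "0 < s" for s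
    using realize_gcompl[where Q = "\<lambda>a b c. a", OF C(1)[OF that]]
      realize_gcompl[where Q = "\<lambda>a b c. \<not> a \<and> \<not> b \<and> c", OF C(2)[OF that]]
      realize_gcompl[where Q = "\<lambda>a b c. \<not> a \<and> \<not> b \<and> \<not> c", OF C(3)[OF that]]
      realize_gcompl[where Q = "\<lambda>a b c. b \<and> c", OF C(4)[OF that]]
      realize_gcompl[where Q = "\<lambda>a b c. b \<and> \<not> c", OF C(5)[OF that]] by simp_all
  show "\<forall>s::nat. 0 < s \<longrightarrow>
            (\<forall>\<phi> \<in> {phiC1,
                    \<lambda>G. \<not> phiC1 G \<and> \<not> phiC2 G \<and> phiC3 G,
                    \<lambda>G. \<not> phiC1 G \<and> \<not> phiC2 G \<and> \<not> phiC3 G,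
                    \<lambda>G. phiC2 G \<and> phiC3 G,
                    \<lambda>G. phiC2 G \<and> \<not> phiC3 G}.
               \<exists>G. is_graph G \<and> ext_prop s G \<and> \<phi> G)
          \<and> (\<forall>\<phi> \<in> {phiI1,
                    \<lambda>G. \<not> phiI1 G \<and> \<not> phiI2 G \<and> phiI3 G,
                    \<lambda>G. \<not> phiI1 G \<and> \<not> phiI2 G \<and> \<not> phiI3 G,
                    \<lambda>G. phiI2 G \<and> phiI3 G,
                    \<lambda>G. phiI2 G \<and> \<not> phiI3 G}.
               \<exists>G. is_graph G \<and> ext_prop s G \<and> \<phi> G)"
    using C I by simp
qed

end
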